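(* Let $w_1,\dots,w_6$ be negative integers such that the linking matrix $W$ of the H-graph $\Gamma$ with weights $w_1,\dots,w_6$ is negative definite and $\det W=1$. Let $S$ be the upper-left $2\times2$ block of $-W^{-1}$, $M:=w_3w_4$, $N:=w_5w_6$, and let $k$ be a positive integer. Then $$\tau_k(M_3(\Gamma))=\frac{\mathrm i\,\zeta_k^{-(18+\sum_{v=1}^6w_v+\sum_{v=3}^61/w_v)/4}}{4k(\zeta_{2k}-\zeta_{2k}^{-1})\sqrt{MN}}\sum_{\substack{m\in(\mathbb Z\smallsetminus k\mathbb Z)/2kw_3w_4\mathbb Z\\ n\in(\mathbb Z\smallsetminus k\mathbb Z)/2kw_5w_6\mathbb Z}}\zeta_k^{-(m,n)S^{-1}(m,n)^\top/4}\,A_m\,A'_n,$$ where $$A_m=\frac{(\zeta_k^{m/(2w_3)}-\zeta_k^{-m/(2w_3)})(\zeta_k^{m/(2w_4)}-\zeta_k^{-m/(2w_4)})}{\zeta_k^{m/2}-\zeta_k^{-m/2}},\qquad A'_n=\frac{(\zeta_k^{n/(2w_5)}-\zeta_k^{-n/(2w_5)})(\zeta_k^{n/(2w_6)}-\zeta_k^{-n/(2w_6)})}{\zeta_k^{n/2}-\zeta_k^{-n/2}},$$ and thus $$\tau_k(M_3(\Gamma))=\frac{\mathrm i\,\zeta_k^{-(18+\sum_{v=1}^6w_v+\sum_{v=3}^61/w_v)/4}}{4k(\zeta_{2k}-\zeta_{2k}^{-1})\sqrt{MN}}\sum_{\mu=(m,n)^\top\in(\mathbb Z\smallsetminus k\mathbb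 Z)^2/2kS(\mathbb Z^2)}\zeta_k^{-\mu^\top S^{-1}\mu/4}\,G^{\omega}(\zeta_k^{m/(2M)})\,G^{\varpi}(\zeta_k^{n/(2N)}),$$ where $\omega:=(w_3,w_4)$, $\varpi:=(w_5,w_6)$, and $$G^{(w,w')}(z):=\frac{(z^w-z^{-w})(z^{w'}-z^{-w'})}{z^{ww'}-z^{-ww'}}=-\sum_{n=1}^\infty\chi^{(w,w')}(n)z^n.$$
   Context: Notation: $\zeta_k:=e^{2\pi \mathrm i/k}$ and $\zeta_k^r:=e^{2\pi \mathrm i r/k}$ for $r\in\mathbb Q$. The H-graph $\Gamma$ is the tree with vertices $1,\dots,6$, edges $\{1,2\},\{1,3\},\{1,4\},\{2,5\},\{2,6\}$, and integer weight $w_v$ at vertex $v$. Its linking matrix $W$ is the symmetric $6\times 6$ matrix with $W_{vv}=w_v$, $W_{vv'}=1$ if $\{v,v'\}$ is an edge and $0$ otherwise. $M_3(\Gamma)$ is the closed oriented $3$-manifold obtained from $S^3$ by surgery along the framed link with one unknotted component of framing $w_v$ for each vertex $v$, two components being linked (as a Hopf link) exactly when the corresponding vertices are adjacent. $\tau_k$ denotes the $\mathrm{SU}(2)$ Witten--Reshetikhin--Turaev invariant normalised by $\tau_k(S^3)=1$; for $M_3(\Gamma)$ it is given by $$\tau_k(M_3(\Gamma))=\frac{-\mathrm i\,\zeta_k^{-9/2}}{16k^3(\zeta_{2k}-\zeta_{2k}^{-1})}\sum_{l\in(\mathbb Z\smallsetminus k\mathbb Z)^6/2k\mathbb Z^6}\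 \prod_{v=1}^6\zeta_k^{w_v(l_v^2-1)/4}\left(\frac1{\zeta_k^{l_v/2}-\zeta_k^{-l_v/2}}\right)^{\deg(v)-2}\prod_{\{v,v'\}\ \mathrm{edge}}\frac{\zeta_k^{l_vl_{v'}/2}-\zeta_k^{-l_vl_{v'}/2}}2 ,$$ where $\deg(v)$ is the degree of $v$ in $\Gamma$. For non-zero integers $w,w'$, the map $\chi^{(w,w')}\colon\mathbb Z\to\mathbb Z/2ww'\mathbb Z\to\{\pm1,0\}$ is defined by $\chi^{(w,w')}(n):=ee'$ if $n\equiv w'e+we'+ww'\pmod{2ww'}$ for some $e,e'\in\{\pm1\}$, and $0$ otherwise. One has $S(\mathbb Z^2)=M\mathbb Z\oplus N\mathbb Z$.
   Formalization: The series identity for G^{(w,w')} is stated for |z|<1 and only when |w|,|w'|>1: the hypotheses allow a leaf of weight −1, where χ is ill-defined and G(z)=z−1/z is no power series. For arbitrary pairs it also assumes ww'>0 and w≠w'. *)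

theory Defs
  imports "HOL-Analysis.Analysis"
begin

definition zeta :: "nat \<Rightarrow> real \<Rightarrow> complex" where
  "zeta k r = exp (2 * of_real pi * \<i> * of_real r / of_nat k)"

text \<open>
  Sum of \<open>f\<close> over \<open>X / L\<close>, where \<open>L\<close> is a subgroup of the ambient abelian group and
  \<open>X\<close> is a union of cosets of \<open>L\<close>.  The representative of each class is arbitrary: by
  \<open>coset_sum_transversal\<close> below it does not matter when \<open>f\<close> is invariant under \<open>L\<close>,
  as all the summands used here are.
\<close>

definition coset_rel :: "'a::ab_group_add set \<Rightarrow> 'a set \<Rightarrow> ('a \<times> 'a) set" where
  "coset_rel X L = {(x, y) \<in> X \<times> X. x - y \<in> L}"

definition coset_sum :: "'a::ab_group_add set \<Rightarrow> 'a set \<Rightarrow> ('a \<Rightarrow> complex) \<Rightarrow> complex" where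
  "coset_sum X L f = (\<Sum>C \<in> X // coset_rel X L. f (SOME x. x \<in> C))"

lemma coset_sum_transversal:
  assumes zero: "0 \<in> L" and diff: "\<And>a b. a \<in> L \<Longrightarrow> b \<in> L \<Longrightarrow> a - b \<in> L"
    and inv: "\<And>x y. x \<in> X \<Longrightarrow> y \<in> X \<Longrightarrow> x - y \<in> L \<Longrightarrow> f x = f y"
    and R: "R \<subseteq> X" "\<And>x. x \<in> X \<Longrightarrow> \<exists>!r. r \<in> R \<and> x - r \<in> L"
  shows "coset_sum X L f = (\<Sum>r\<in>R. f r)"
proof -
  let ?E = "coset_rel X L"
  have neg: "b - a \<in> L" if "a - b \<in> L" for a b
    using diff[OF zero that] by simp
  have add: "a - c \<in> L" if "a - b \<in> L" "b - c \<in> L" for a b c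
    using diff[OF that(1) neg[OF that(2)]] by simp
  have eq: "equiv X ?E"
  proof (rule equivI)
    show "?E \<subseteq> X \<times> X" by (auto simp: coset_rel_def)
    show "refl_on X ?E" using zero by (simp add: refl_on_def coset_rel_def)
    show "sym ?E" unfolding sym_def coset_rel_def using neg by fast
    show "trans ?E"
    proof (rule transI)
      fix a b c assume "(a, b) \<in> ?E" "(b, c) \<in> ?E"
      then show "(a, c) \<in> ?E" using add[of a b c] by (simp add: coset_rel_def)
    qed
  qed
  have bij: "bij_betw (\<lambda>r. ?E `` {r}) R (X // ?E)"
    unfolding bij_betw_def
  proof
    show "inj_on (\<lambda>r. ?E `` {r}) R"
    proof (rule inj_onI)
      fix r s assume rs: "r \<in> R" "s \<in> R" "?E `` {r} = ?E `` {s}"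
      then have "(r, s) \<in> ?E"
        using eq_equiv_class[OF rs(3) eq] R(1) by blast
      then have "r - s \<in> L" by (simp add: coset_rel_def)
      moreover have "r - r \<in> L" using zero by simp
      moreover have "r \<in> X" using rs R(1) by blast
      ultimately show "r = s" using R(2)[of r] rs(1,2) by blast
    qed
    show "(\<lambda>r. ?E `` {r}) ` R = X // ?E"
    proof
      show "(\<lambda>r. ?E `` {r}) ` R \<subseteq> X // ?E"
        using R(1) by (auto intro: quotientI)
      show "X // ?E \<subseteq> (\<lambda>r. ?E `` {r}) ` R"
      proof
        fix C assume "C \<in> X // ?E"
        then obtain x where x: "x \<in> X" "C = ?E `` {x}" by (auto elim: quotientE)
        obtain r where r: "r \<in> R" "x - r \<in> L" using R(2)[OF x(1)] by blast
        then have "(x, r) \<in> ?E" using x R(1) by (auto simp: coset_rel_def)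
        then have "C = ?E `` {r}" using x equiv_class_eq[OF eq] by blast
        then show "C \<in> (\<lambda>r. ?E `` {r}) ` R" using r by blast
      qed
    qed
  qed
  have val: "f (SOME x. x \<in> ?E `` {r}) = f r" if "r \<in> R" for r
  proof -
    have "r \<in> ?E `` {r}" using that R(1) zero by (auto simp: coset_rel_def)
    then have "(SOME x. x \<in> ?E `` {r}) \<in> ?E `` {r}" by (rule someI)
    then have "(r, SOME x. x \<in> ?E `` {r}) \<in> ?E" by (rule Image_singleton_iff[THEN iffD1])
    moreover have "f r = f s" if "(r, s) \<in> ?E" for s
      using that inv[of r s] by (simp add: coset_rel_def)
    ultimately show ?thesis by metis
  qed
  have "coset_sum X L f = (\<Sum>r\<in>R. f (SOME x. x \<in> ?E `` {r}))"
    unfolding coset_sum_def by (rule sum.reindex_bij_betw[OF bij, symmetric])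
  then show ?thesis using val by simp
qed

text \<open>
  The vertices are the elements of the numeral type \<open>6\<close>, in which \<open>1, \<dots>, 6\<close> are
  distinct and \<open>6 = 0\<close>; its order is not used.
\<close>

definition H_edges :: "6 set set" where
  "H_edges = {{1,2}, {1,3}, {1,4}, {2,5}, {2,6}}"

definition H_degree :: "6 \<Rightarrow> nat" where
  "H_degree v = card {v'. {v, v'} \<in> H_edges}"

definition linking_matrix :: "int ^ 6 \<Rightarrow> real ^ 6 ^ 6" where
  "linking_matrix w =
     (\<chi> v v'. if v = v' then of_int (w $ v) else if {v, v'} \<in> H_edges then 1 else 0)"

definition negative_definite :: "real ^ 'n ^ 'n \<Rightarrow> bool" where
  "negative_definite A \<longleftrightarrow> (\<forall>x. x \<noteq> 0 \<longrightarrow> x \<bullet> (A *v x) < 0)"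

text \<open>Upper-left block of \<open>- W\<inverse>\<close> (rows and columns 1 and 2).\<close>

definition S_block :: "int ^ 6 \<Rightarrow> real ^ 2 ^ 2" where
  "S_block w =
     (let e = (\<lambda>i :: 2. if i = 1 then 1 else 2 :: 6)
      in \<chi> i j. - (matrix_inv (linking_matrix w) $ e i $ e j))"

text \<open>
  The \<open>SU(2)\<close> Witten--Reshetikhin--Turaev invariant of \<open>M\<^sub>3(\<Gamma>)\<close>, normalised to be 1 on
  the 3-sphere, by its surgery formula.  In the product over the edges,
  \<open>\<Prod>v\<in>e. l $ v\<close> is the product of the labels of the two ends of \<open>e\<close>.
\<close>

definition tau :: "nat \<Rightarrow> int ^ 6 \<Rightarrow> complex" where
  "tau k w =
     - \<i> * zeta k (- 9 / 2) / (16 * of_nat k ^ 3 * (zeta (2 * k) 1 - inverse (zeta (2 * k) 1))) *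
     coset_sum {l :: int ^ 6. \<forall>v. \<not> int k dvd l $ v} (range (\<lambda>x. \<chi> v. 2 * int k * x $ v))
       (\<lambda>l. (\<Prod>v\<in>UNIV.
               zeta k (of_int (w $ v) * (of_int (l $ v) ^ 2 - 1) / 4) *
               (1 / (zeta k (of_int (l $ v) / 2) - zeta k (- of_int (l $ v) / 2)))
                 powi (int (H_degree v) - 2)) *
            (\<Prod>e\<in>H_edges.
               (zeta k (of_int (\<Prod>v\<in>e. l $ v) / 2) - zeta k (- of_int (\<Prod>v\<in>e. l $ v) / 2)) / 2))"

text \<open>
  For some pairs, for instance when \<open>w\<close> or \<open>w'\<close> is 1 or -1, a residue class can be written
  in two ways with different signs; then \<open>chi\<close> takes an unspecified one of them.
\<close>

definition chi :: "int \<Rightarrow> int \<Rightarrow> int \<Rightarrow> int" where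
  "chi w w' n =
     (let P = (\<lambda>s. \<exists>e\<in>{1, -1}. \<exists>e'\<in>{1, -1}.
                 s = e * e' \<and> n mod (2 * w * w') = (w' * e + w * e' + w * w') mod (2 * w * w'))
      in if \<exists>s. P s then SOME s. P s else 0)"

definition G :: "int \<Rightarrow> int \<Rightarrow> complex \<Rightarrow> complex" where
  "G w w' z = (z powi w - z powi (- w)) * (z powi w' - z powi (- w'))
              / (z powi (w * w') - z powi (- (w * w')))"

definition A_coeff :: "nat \<Rightarrow> int \<Rightarrow> int \<Rightarrow> int \<Rightarrow> complex" where
  "A_coeff k w w' m =
     (zeta k (of_int m / (2 * of_int w)) - zeta k (- of_int m / (2 * of_int w))) *
     (zeta k (of_int m / (2 * of_int w')) - zeta k (- of_int m / (2 * of_int w'))) /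
     (zeta k (of_int m / 2) - zeta k (- of_int m / 2))"

end

theory Submission
  imports Defs "HOL-Complex_Analysis.Cauchy_Integral_Formula" "HOL-Probability.Distributions"
    "HOL-Number_Theory.Cong" "HOL-Real_Asymp.Real_Asymp"
begin

text \<open>
  For fixed labels \<open>m\<close>, \<open>n\<close> of the two inner vertices the surgery sum factors
      over the four leaves,
  and the sum over a leaf of weight \<open>w\<close> is a difference of two quadratic Gauss sums modulo
      \<open>2k\<close>.
  Reciprocity turns it into a sum over the lifts \<open>x = m + 2kn\<close> of \<open>m\<close> modulo
      \<open>2kw\<close>.
  Expanding \<open>det W = 1\<close> shows that the two leaves at an inner vertex have coprime weights, so by the
  Chinese remainder theorem the two lifts of \<open>m\<close> combine into a single one modulo
      \<open>2kM\<close>; likewise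
  for \<open>n\<close>.  The remaining phase is the quadratic form of the Schur complement of the leaves in
      \<open>W\<close>,
  which is \<open>-S\<inverse>\<close>.

  Gauss reciprocity itself comes from integrating \<open>\<phi>(z) / (exp (2\<pi>iz) - 1)\<close>, with
      \<open>\<phi>\<close> a quadratic
  exponential, along the parallel lines \<open>x + t (1 + i)\<close>, on which \<open>\<phi>\<close> decays
      like a Gaussian.
\<close>

section \<open>Gauss sum reciprocity\<close>

lemma contour_integral_linepath_translate:
  "contour_integral (linepath (a + d) (b + d)) f = contour_integral (linepath a b) (\<lambda>z. f (z + d))"
  by (simp add: contour_integral_integral linepath_def algebra_simps)

lemma holomorphic_linepath_primitive:
  assumes "convex S" "open S" "f holomorphic_on S"
  obtains F where "\<And>a b. a \<in> S \<Longrightarrow> b \<in> S \<Longrightarrow> (f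
      has_contour_integral F b - F a) (linepath a b)"
proof -
  obtain F where F: "\<And>x. x \<in> S \<Longrightarrow> (F has_field_derivative f x) (at x within S)"
    using holomorphic_convex_primitive'[OF assms] by blast
  have "(f has_contour_integral F b - F a) (linepath a b)" if "a \<in> S" "b \<in> S" for a b
    using contour_integral_primitive[OF F, of "linepath a b"] that assms(1)
    by (simp add: closed_segment_subset)
  then show thesis using that by blast
qed

definition skew_point :: "real \<Rightarrow> real \<Rightarrow> complex" where
  "skew_point x t = Complex (x + t) t"

definition skew_integral :: "(complex \<Rightarrow> complex) \<Rightarrow> real \<Rightarrow> real
    \<Rightarrow> complex" where
  "skew_integral f x T = contour_integral (linepath (skew_point x (-T)) (skew_point x T)) f"

definition gauss_kernel :: "real \<Rightarrow> real \<Rightarrow> complex \<Rightarrow> complex" where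
  "gauss_kernel A \<beta> z = exp (\<i> * of_real pi * of_real A * z\<^sup>2 + 2 * \<i> * of_real pi *
      of_real \<beta> * z)"

lemma skew_integral_translate:
  "skew_integral f (x + y) T = skew_integral (\<lambda>z. f (z + of_real y)) x T"
proof -
  have "skew_point (x + y) t = skew_point x t + of_real y" for t
    by (simp add: skew_point_def complex_eq_iff)
  then show ?thesis
    by (simp add: skew_integral_def contour_integral_linepath_translate)
qed

lemma has_contour_integral_inverse_linepath:
  assumes "closed_segment a b \<inter> \<real>\<^sub>\<le>\<^sub>0 = {}"
  shows "((\<lambda>z. 1 / z) has_contour_integral (Ln b - Ln a)) (linepath a b)"
proof -
  have "(Ln has_field_derivative 1 / z) (at z within - \<real>\<^sub>\<le>\<^sub>0)" if "z \<in> -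
      \<real>\<^sub>\<le>\<^sub>0" for z
    using that by (auto intro!: derivative_eq_intros simp: field_simps)
  then show ?thesis
    using contour_integral_primitive[of "- \<real>\<^sub>\<le>\<^sub>0" Ln "\<lambda>z. 1 / z" "linepath a
        b"] assms
    by auto
qed

lemma closed_segment_skew:
  "z \<in> closed_segment (skew_point x s) (skew_point x t) \<Longrightarrow> Re z - Im z = x"
  by (auto simp: in_segment skew_point_def) (simp add: algebra_simps)

lemma closed_segment_horizontal:
  assumes "z \<in> closed_segment (skew_point x t) (skew_point y t)"
  obtains u where "u \<in> closed_segment x y" "z = skew_point u t"
proof -
  obtain r where r: "0 \<le> r" "r \<le> 1" "z = (1 - r) *\<^sub>R skew_point x t + r *\<^sub>R skew_point y t"
    using assms by (auto simp: in_segment)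
  have "z = skew_point ((1 - r) *\<^sub>R x + r *\<^sub>R y) t"
    by (simp add: r(3) skew_point_def complex_eq_iff algebra_simps)
  moreover have "(1 - r) *\<^sub>R x + r *\<^sub>R y \<in> closed_segment x y"
    using r by (auto simp: in_segment)
  ultimately show thesis using that by blast
qed

text \<open>Only the left side of the parallelogram meets the branch cut of \<open>Ln\<close>; there
    \<open>Ln (- z)\<close> is a primitive.\<close>

lemma skew_residue_inverse:
  assumes "T > 0"
  shows "skew_integral (\<lambda>z. 1 / z) (1/2) T - skew_integral (\<lambda>z. 1 / z) (- (1/2)) T =
    2 * of_real pi * \<i>
    + contour_integral (linepath (skew_point (- (1/2)) T) (skew_point (1/2) T)) (\<lambda>z. 1 / z)
    - contour_integral (linepath (skew_point (- (1/2)) (-T)) (skew_point (1/2) (-T))) (\<lambda>z. 1 / z)"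
proof -
  let ?p = skew_point
  have horiz: "contour_integral (linepath (?p (- (1/2)) t) (?p (1/2) t)) (\<lambda>z. 1 / z)
      = Ln (?p (1/2) t) - Ln (?p (- (1/2)) t)" if "t \<noteq> 0" for t
  proof -
    have "closed_segment (?p (- (1/2)) t) (?p (1/2) t) \<inter> \<real>\<^sub>\<le>\<^sub>0 = {}"
    proof -
      have False if z: "z \<in> closed_segment (?p (- (1/2)) t) (?p (1/2) t)" "z \<in>
          \<real>\<^sub>\<le>\<^sub>0" for z
        using closed_segment_horizontal[OF z(1)] z(2) \<open>t \<noteq> 0\<close>
        by (metis complex.sel(2) complex_nonpos_Reals_iff skew_point_def)
      then show ?thesis by blast
    qed
    then show ?thesis by (intro contour_integral_unique has_contour_integral_inverse_linepath)
  qed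
  have right: "skew_integral (\<lambda>z. 1 / z) (1/2) T = Ln (?p (1/2) T) - Ln (?p (1/2) (-T))"
  proof -
    have "closed_segment (?p (1/2) (-T)) (?p (1/2) T) \<inter> \<real>\<^sub>\<le>\<^sub>0 = {}"
      using closed_segment_skew[of _ "1/2" "-T" T] by (fastforce simp: complex_nonpos_Reals_iff)
    then show ?thesis unfolding skew_integral_def
      by (intro contour_integral_unique has_contour_integral_inverse_linepath)
  qed
  have left: "skew_integral (\<lambda>z. 1 / z) (- (1/2)) T = Ln (- ?p (- (1/2)) T) - Ln (- ?p (- (1/2)) (-T))"
  proof -
    have D: "((\<lambda>z. Ln (- z)) has_field_derivative 1 / z) (at z within - \<real>\<^sub>\<ge>\<^sub>0)"
      if "z \<in> - \<real>\<^sub>\<ge>\<^sub>0" for z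
    proof -
      have "- z \<notin> \<real>\<^sub>\<le>\<^sub>0" "z \<noteq> 0"
        using that by (auto simp: complex_nonpos_Reals_iff complex_nonneg_Reals_iff)
      then show ?thesis by (auto intro!: derivative_eq_intros simp: field_simps)
    qed
    have "closed_segment (?p (- (1/2)) (-T)) (?p (- (1/2)) T) \<inter> \<real>\<^sub>\<ge>\<^sub>0 = {}"
      using closed_segment_skew[of _ "- (1/2)" "-T" T] by (fastforce simp: complex_nonneg_Reals_iff)
    then show ?thesis unfolding skew_integral_def
      using contour_integral_primitive[OF D, where g="linepath (?p (- (1/2)) (-T)) (?p (- (1/2)) T)"]
      by (intro contour_integral_unique) auto
  qed
  have "Ln (- ?p (- (1/2)) T) = Ln (?p (- (1/2)) T) - \<i> * pi"
    "Ln (- ?p (- (1/2)) (-T)) = Ln (?p (- (1/2)) (-T)) + \<i> * pi"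
    using assms by (subst Ln_minus; auto simp: skew_point_def complex_eq_iff)+
  then show ?thesis using assms by (simp add: horiz right left)
qed

lemma norm_gauss_kernel:
  "norm (gauss_kernel A \<beta> (skew_point x t)) = exp (- 2 * pi * (A * (x + t) * t + \<beta> * t))"
  by (simp add: gauss_kernel_def skew_point_def norm_exp_eq_Re power2_eq_square algebra_simps)

lemma norm_gauss_kernel_le:
  assumes "A > 0" "\<bar>x\<bar> \<le> X" "\<bar>t\<bar> = T"
  shows "norm (gauss_kernel A \<beta> (skew_point x t)) \<le> exp (2 * pi * ((A * X + \<bar>\<beta>\<bar>)
      * T - A * T\<^sup>2))"
proof -
  have "- (A * x * t) \<le> A * X * T"
  proof -
    have "- (A * x * t) \<le> \<bar>A * x * t\<bar>" by linarith
    also have "\<dots> \<le> A * X * T" using assms by (auto simp: abs_mult intro!: mult_mono)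
    finally show ?thesis .
  qed
  moreover have "- (\<beta> * t) \<le> \<bar>\<beta>\<bar> * T"
    using assms(3) abs_ge_minus_self[of "\<beta> * t"] by (simp add: abs_mult)
  moreover have "t * t = T\<^sup>2" using assms(3) by (auto simp: power2_eq_square)
  moreover have "- (A * (x + t) * t + \<beta> * t) = - (A * x * t) - \<beta> * t - A * (t * t)"
    "(A * X + \<bar>\<beta>\<bar>) * T - A * T\<^sup>2 = A * X * T + \<bar>\<beta>\<bar> * T - A * T\<^sup>2"
    by (simp_all add: algebra_simps)
  ultimately have "- (A * (x + t) * t + \<beta> * t) \<le> (A * X + \<bar>\<beta>\<bar>) * T - A * T\<^sup>2"
    by simp
  then have "2 * pi * (- (A * (x + t) * t + \<beta> * t)) \<le> 2 * pi * ((A * X + \<bar>\<beta>\<bar>) * T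
      - A * T\<^sup>2)"
    by (rule mult_left_mono) simp
  then show ?thesis by (simp only: norm_gauss_kernel exp_le_cancel_iff mult_minus_left mult_minus_right)
qed

lemma gauss_decay:
  assumes "(A::real) > 0"
  shows "((\<lambda>T. C * exp (2 * pi * (B * T - A * T\<^sup>2))) \<longlongrightarrow> 0) at_top"
  using assms by real_asymp

lemma horizontal_integral_tendsto_0:
  assumes A: "A > 0" and s: "\<bar>s\<bar> = 1"
    and bound: "\<And>u t. \<bar>t\<bar> \<ge> 1 \<Longrightarrow> u \<in> closed_segment x y \<Longrightarrow>
      norm (f (skew_point u t)) \<le> C * norm (gauss_kernel A \<beta> (skew_point u t))"
  shows "((\<lambda>T. contour_integral (linepath (skew_point x (s * T)) (skew_point y (s * T))) f)
      \<longlongrightarrow> 0) at_top"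
proof (rule Lim_null_comparison)
  let ?X = "max \<bar>x\<bar> \<bar>y\<bar>"
  let ?B = "\<lambda>T. \<bar>C\<bar> * exp (2 * pi * ((A * ?X + \<bar>\<beta>\<bar>) * T - A * T\<^sup>2))"
  show "((\<lambda>T. ?B T * \<bar>y - x\<bar>) \<longlongrightarrow> 0) at_top"
    using tendsto_mult_left_zero[OF gauss_decay[OF A]] .
  show "\<forall>\<^sub>F T in at_top. norm (contour_integral (linepath (skew_point x (s * T)) (skew_point
      y (s * T))) f)
    \<le> ?B T * \<bar>y - x\<bar>"
    using eventually_ge_at_top[of 1]
  proof eventually_elim
    case (elim T)
    let ?p = "linepath (skew_point x (s * T)) (skew_point y (s * T))"
    have T: "\<bar>s * T\<bar> = T" using s elim by (simp add: abs_mult)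
    have len: "norm (skew_point y (s * T) - skew_point x (s * T)) = \<bar>y - x\<bar>"
      by (simp add: skew_point_def cmod_def)
    show ?case
    proof (cases "f contour_integrable_on ?p")
      case True
      have "norm (f z) \<le> ?B T" if z: "z \<in> closed_segment (skew_point x (s * T)) (skew_point y (s *
          T))" for z
      proof -
        obtain u where u: "u \<in> closed_segment x y" "z = skew_point u (s * T)"
          using closed_segment_horizontal[OF z] by blast
        have "\<bar>u\<bar> \<le> ?X" using u(1) by (auto simp: closed_segment_eq_real_ivl split: if_splits)
        then have "norm (gauss_kernel A \<beta> z) \<le> exp (2 * pi * ((A * ?X + \<bar>\<beta>\<bar>) * T
            - A * T\<^sup>2))"
          unfolding u(2) using A T by (intro norm_gauss_kernel_le)
        moreover have "norm (f z) \<le> \<bar>C\<bar> * norm (gauss_kernel A \<beta> z)"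
          using bound[OF _ u(1), of "s * T"] T elim
            mult_right_mono[OF abs_ge_self norm_ge_zero, of C "gauss_kernel A \<beta> z"]
          unfolding u(2) by (metis order_trans)
        ultimately show ?thesis by (meson abs_ge_zero mult_left_mono order_trans)
      qed
      then show ?thesis
        using contour_integral_bound_linepath[OF True, of "?B T"] by (simp add: len)
    next
      case False
      then show ?thesis by (simp add: not_integrable_contour_integral)
    qed
  qed
qed

lemma gauss_kernel_holomorphic [holomorphic_intros]: "gauss_kernel A \<beta> holomorphic_on S"
  unfolding gauss_kernel_def by (intro holomorphic_intros)

lemma gauss_kernel_complete_square:
  assumes "A > 0"
  shows "gauss_kernel A \<beta> z = exp (- \<i> * of_real pi * of_real (\<beta>\<^sup>2 / A)) *
      gauss_kernel A 0 (z + of_real (\<beta> / A))"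
proof -
  define \<gamma> where "\<gamma> = \<beta> / A"
  have "\<beta> = A * \<gamma>" using assms by (simp add: \<gamma>_def)
  then show ?thesis using assms unfolding gauss_kernel_def exp_add[symmetric]
    by (simp add: algebra_simps power2_eq_square)
qed

lemma gauss_integral_tendsto:
  assumes "s > 0"
  shows "((\<lambda>T. integral {-T..T} (\<lambda>t::real. exp (- s * t\<^sup>2))) \<longlongrightarrow>
      sqrt (pi / s)) at_top"
proof -
  define \<sigma> where "\<sigma> = 1 / sqrt (2 * s)"
  have \<sigma>: "\<sigma> > 0" "2 * \<sigma>\<^sup>2 = 1 / s" using assms by (simp_all add: \<sigma>_def
      power_divide)
  have dens: "exp (- s * t\<^sup>2) = sqrt (pi / s) * normal_density 0 \<sigma> t" for t
    using assms \<sigma>(2) by (simp add: normal_density_def real_sqrt_divide mult.assoc[of _ pi]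
        mult.left_commute[of _ pi])
  have int: "set_integrable lborel {-T..T} (\<lambda>t. exp (- s * t\<^sup>2))" for T
    by (intro borel_integrable_atLeastAtMost') (auto intro!: continuous_intros)
  have "((\<lambda>T. LINT t|lborel. indicator {-T..T} t *\<^sub>R exp (- s * t\<^sup>2)) \<longlongrightarrow>
      (LINT t|lborel. exp (- s * t\<^sup>2))) at_top"
  proof (rule integral_dominated_convergence_at_top)
    show "AE t in lborel. ((\<lambda>T. indicator {-T..T} t *\<^sub>R exp (- s * t\<^sup>2))
        \<longlongrightarrow> exp (- s * t\<^sup>2)) at_top"
    proof (intro AE_I2 tendsto_eventually)
      fix t :: real
      show "\<forall>\<^sub>F T in at_top. indicator {-T..T} t *\<^sub>R exp (- s * t\<^sup>2) = exp (- s *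
          t\<^sup>2)"
        using eventually_ge_at_top[of "\<bar>t\<bar>"] by eventually_elim (auto simp: indicator_def)
    qed
    show "integrable lborel (\<lambda>t. exp (- s * t\<^sup>2))"
      unfolding dens using \<sigma>(1) by (intro integrable_mult_right integrable_normal_density)
  qed (auto simp: indicator_def)
  moreover have "(LINT t|lborel. exp (- s * t\<^sup>2)) = sqrt (pi / s)"
    unfolding dens using \<sigma>(1) by (simp add: integral_normal_density)
  moreover have "(LINT t|lborel. indicator {-T..T} t *\<^sub>R exp (- s * t\<^sup>2)) = integral {-T..T}
      (\<lambda>t. exp (- s * t\<^sup>2))" for T
    using set_borel_integral_eq_integral(2)[OF int] by (simp add: set_lebesgue_integral_def)
  ultimately show ?thesis by simp
qed

lemma skew_integral_gauss_0:
  assumes "A > 0"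
  shows "((\<lambda>T. skew_integral (gauss_kernel A 0) 0 T) \<longlongrightarrow> of_real (1 / sqrt (2 *
      A)) * (1 + \<i>)) at_top"
proof (rule Lim_transform_eventually)
  show "((\<lambda>T. of_real (integral {-T..T} (\<lambda>t::real. exp (- (2 * pi * A) * t\<^sup>2))) * (1
      + \<i>)) \<longlongrightarrow>
     of_real (1 / sqrt (2 * A)) * (1 + \<i>)) at_top"
    using gauss_integral_tendsto[of "2 * pi * A"] assms
    by (intro tendsto_intros) (simp add: real_sqrt_divide)
  show "\<forall>\<^sub>F T in at_top. of_real (integral {-T..T} (\<lambda>t::real. exp (- (2 * pi * A) *
      t\<^sup>2))) * (1 + \<i>) =
    skew_integral (gauss_kernel A 0) 0 T"
    using eventually_gt_at_top[of 0]
  proof eventually_elim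
    case (elim T)
    let ?e = "\<lambda>t::real. exp (- (2 * pi * A) * t\<^sup>2)"
    have "(?e has_integral integral {-T..T} ?e) (cbox (-T) T)"
      by (auto intro!: integrable_integral integrable_continuous_real continuous_intros)
    from has_integral_affinity[OF this, of "2 * T" "-T"] elim
    have "((\<lambda>t. ?e (2 * T * t - T)) has_integral (1 / (2 * T)) *\<^sub>R integral {-T..T} ?e)
        ((\<lambda>x. (1 / (2 * T)) *\<^sub>R x + 1 / 2) ` {-T..T})"
      by (simp add: field_simps)
    moreover have "(\<lambda>x. (1 / (2 * T)) *\<^sub>R x + 1 / 2) ` {-T..T} = {0..1}"
      using elim image_affinity_atLeastAtMost[of "1 / (2 * T)" "1 / 2" "-T" T] by (simp add: field_simps)
    ultimately have "((\<lambda>t. ?e (2 * T * t - T)) has_integral (1 / (2 * T)) *\<^sub>R integral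
        {-T..T} ?e) {0..1}"
      by simp
    then have "((\<lambda>t. complex_of_real (?e (2 * T * t - T)) * (2 * of_real T * (1 + \<i>))) has_integral
       of_real ((1 / (2 * T)) *\<^sub>R integral {-T..T} ?e) * (2 * of_real T * (1 + \<i>))) {0..1}"
      by (intro has_integral_mult_left has_integral_of_real)
    moreover have "gauss_kernel A 0 (linepath (skew_point 0 (-T)) (skew_point 0 T) t) = of_real (?e (2 * T
        * t - T))" for t
    proof -
      have "linepath (skew_point 0 (-T)) (skew_point 0 T) t = of_real (2 * T * t - T) * (1 + \<i>)"
        by (simp add: linepath_def skew_point_def complex_eq_iff algebra_simps)
      moreover have "gauss_kernel A 0 (of_real r * (1 + \<i>)) = of_real (exp (- (2 * pi * A) * r\<^sup>2))" for r
        by (simp add: gauss_kernel_def power_mult_distrib exp_of_real[symmetric])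
          (simp add: power2_eq_square algebra_simps)
      ultimately show ?thesis by (simp only:)
    qed
    moreover have "skew_point 0 T - skew_point 0 (-T) = 2 * of_real T * (1 + \<i>)"
      by (simp add: skew_point_def complex_eq_iff)
    ultimately have "(gauss_kernel A 0 has_contour_integral of_real (integral {-T..T} ?e) * (1 + \<i>))
        (linepath (skew_point 0 (-T)) (skew_point 0 T))"
      using elim by (simp add: has_contour_integral_linepath)
    then show ?case by (simp add: skew_integral_def contour_integral_unique)
  qed
qed

lemma contour_integrable_linepath_continuous:
  "continuous_on UNIV f \<Longrightarrow> f contour_integrable_on linepath a b"
  by (rule contour_integrable_continuous_linepath) (rule continuous_on_subset, auto)

lemma skew_integral_gauss:
  assumes A: "A > 0"
  shows "((\<lambda>T. skew_integral (gauss_kernel A \<beta>) x T) \<longlongrightarrow>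
    exp (- \<i> * of_real pi * of_real (\<beta>\<^sup>2 / A)) * (of_real (1 / sqrt (2 * A)) * (1 + \<i>))) at_top"
proof -
  let ?f = "gauss_kernel A 0"
  define y where "y = x + \<beta> / A"
  have f: "?f holomorphic_on UNIV" by (rule gauss_kernel_holomorphic)
  obtain F where F: "\<And>a b. (?f has_contour_integral F b - F a) (linepath a b)"
    using holomorphic_linepath_primitive[OF convex_UNIV open_UNIV f] by auto
  let ?h = "\<lambda>s T. contour_integral (linepath (skew_point 0 (s * T)) (skew_point y (s * T))) ?f"
  have h0: "((\<lambda>T. ?h s T) \<longlongrightarrow> 0) at_top" if "\<bar>s\<bar> = 1" for s
    by (rule horizontal_integral_tendsto_0[OF A that, where C=1 and \<beta>=0]) simp
  have "skew_integral ?f y T = skew_integral ?f 0 T + ?h 1 T - ?h (-1) T" for T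
    by (simp add: skew_integral_def contour_integral_unique[OF F])
  moreover have "((\<lambda>T. skew_integral ?f 0 T + ?h 1 T - ?h (-1) T) \<longlongrightarrow> of_real (1
      / sqrt (2 * A)) * (1 + \<i>) + 0 - 0) at_top"
    by (intro tendsto_intros skew_integral_gauss_0[OF A] h0) simp_all
  ultimately have lim: "((\<lambda>T. skew_integral ?f y T) \<longlongrightarrow> of_real (1 / sqrt (2 *
      A)) * (1 + \<i>)) at_top"
    by simp
  have "skew_integral (gauss_kernel A \<beta>) x T = exp (- \<i> * of_real pi * of_real (\<beta>\<^sup>2 /
      A)) * skew_integral ?f y T" for T
  proof -
    have "skew_integral (gauss_kernel A \<beta>) x T =
       skew_integral (\<lambda>z. exp (- \<i> * of_real pi * of_real (\<beta>\<^sup>2 / A)) * ?f (z +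
           of_real (\<beta> / A))) x T"
      by (simp only: gauss_kernel_complete_square[OF A, of \<beta>, symmetric])
    also have "\<dots> = exp (- \<i> * of_real pi * of_real (\<beta>\<^sup>2 / A)) * skew_integral
        (\<lambda>z. ?f (z + of_real (\<beta> / A))) x T"
      unfolding skew_integral_def
      by (intro contour_integral_lmul contour_integrable_linepath_continuous holomorphic_on_imp_continuous_on)
        (auto intro!: holomorphic_intros simp: gauss_kernel_def)
    finally show ?thesis by (simp add: y_def skew_integral_translate)
  qed
  then show ?thesis using tendsto_mult_left[OF lim] by simp
qed

lemma exp_2pi_eq_1_skew:
  assumes "exp (2 * of_real pi * \<i> * z) = 1" "\<bar>Re z - Im z\<bar> < 1"
  shows "z = 0"
proof -
  obtain n :: int where "Im z = 0" "2 * pi * Re z = of_int (2 * n) * pi"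
    using assms(1) unfolding exp_eq_1 by auto
  then have "Re z = of_int n" by simp
  with \<open>Im z = 0\<close> assms(2) have "n = 0" by simp
  with \<open>Im z = 0\<close> \<open>Re z = of_int n\<close> show ?thesis by (simp add: complex_eq_iff)
qed

lemma skew_strip: "convex {z. \<bar>Re z - Im z\<bar> < 1}" "open {z. \<bar>Re z - Im z\<bar> < 1}"
proof -
  have eq: "{z. \<bar>Re z - Im z\<bar> < 1} = {z. inner (Complex 1 (-1)) z < 1} \<inter> {z. inner
      (Complex 1 (-1)) z > -1}"
    by (auto simp: inner_complex_def)
  show "convex {z. \<bar>Re z - Im z\<bar> < 1}" "open {z. \<bar>Re z - Im z\<bar> < 1}"
    unfolding eq by (intro convex_Int convex_halfspace_lt convex_halfspace_gt open_Int open_halfspace_lt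
        open_halfspace_gt)+
qed

lemma norm_exp_minus_1_ge:
  assumes "\<bar>t\<bar> \<ge> 1"
  shows "norm (exp (2 * of_real pi * \<i> * skew_point u t) - 1) \<ge> 1 / 2"
proof -
  have n: "norm (exp (2 * of_real pi * \<i> * skew_point u t)) = exp (- (2 * pi * t))"
    by (simp add: norm_exp_eq_Re skew_point_def)
  have pi1: "2 * pi > 1" using pi_gt3 by simp
  have e2: "exp x \<ge> 2" if "x \<ge> 1" for x :: real using exp_ge_add_one_self[of x] that by linarith
  consider "t \<ge> 1" | "t \<le> -1" using assms by linarith
  then show ?thesis
  proof cases
    case 1
    have "2 * pi * t \<ge> 1" using pi1 1 by (smt (verit) mult_le_cancel_left1)
    then have "exp (- (2 * pi * t)) \<le> 1 / 2" using e2[of "2 * pi * t"] by (simp add: exp_minus field_simps)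
    then show ?thesis
      using norm_triangle_ineq2[of 1 "exp (2 * of_real pi * \<i> * skew_point u t)"] n
      by (simp add: norm_minus_commute)
  next
    case 2
    have "- (2 * pi * t) \<ge> 1" using pi1 2 by (smt (verit) mult_le_cancel_left1 mult_minus_right)
    then have "exp (- (2 * pi * t)) \<ge> 2" by (rule e2)
    then show ?thesis
      using norm_triangle_ineq2[of "exp (2 * of_real pi * \<i> * skew_point u t)" 1] n by simp
  qed
qed

lemma skew_integral_residue:
  fixes \<beta> :: real and C :: complex
  assumes A: "A > 0"
  defines "g \<equiv> \<lambda>z. C * gauss_kernel A \<beta> z / (exp (2 * of_real pi * \<i> * z) - 1)"
  shows "((\<lambda>T. skew_integral g (1/2) T - skew_integral g (- (1/2)) T) \<longlongrightarrow> C) at_top"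
proof -
  define S where "S = {z. \<bar>Re z - Im z\<bar> < 1}"
  have S: "convex S" "open S" using skew_strip by (simp_all add: S_def)
  have S0: "0 \<in> S" by (simp add: S_def)
  define E where "E z = exp (2 * of_real pi * \<i> * z) - 1" for z
  have E0: "E z = 0 \<longleftrightarrow> z = 0" if "z \<in> S" for z
    using exp_2pi_eq_1_skew[of z] that by (auto simp: E_def S_def)
  have holE: "E holomorphic_on S" unfolding E_def by (intro holomorphic_intros)
  have derE: "deriv E 0 = 2 * of_real pi * \<i>"
    unfolding E_def by (rule DERIV_imp_deriv) (auto intro!: derivative_eq_intros)
  define q where "q z = (if z = 0 then deriv E 0 else (E z - E 0) / (z - 0))" for z
  have holq: "q holomorphic_on S" unfolding q_def by (rule pole_lemma_open[OF holE S(2)])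
  have q_nz: "q z \<noteq> 0" if "z \<in> S" for z using E0[OF that] E0[OF S0] derE by (auto simp: q_def)
  define f where "f z = C * gauss_kernel A \<beta> z / q z" for z
  have holf: "f holomorphic_on S" unfolding f_def using q_nz by (intro holomorphic_intros holq)
  have f0: "f 0 = C / (2 * of_real pi * \<i>)" by (simp add: f_def q_def derE gauss_kernel_def)
  define h where "h z = (if z = 0 then deriv f 0 else (f z - f 0) / (z - 0))" for z
  have holh: "h holomorphic_on S" unfolding h_def by (rule pole_lemma_open[OF holf S(2)])
  obtain H where H: "\<And>a b. a \<in> S \<Longrightarrow> b \<in> S \<Longrightarrow> (h
      has_contour_integral H b - H a) (linepath a b)"
    using holomorphic_linepath_primitive[OF S holh] by blast
  have g_eq: "g z = f 0 * (1 / z) + h z" if "z \<in> S" "z \<noteq> 0" for z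
    using that E0[OF S0] E0[OF that(1)] unfolding g_def E_def[symmetric]
    by (simp add: h_def f_def[of z] q_def divide_simps)
  have pS: "skew_point (1/2) t \<in> S" "skew_point (- (1/2)) t \<in> S" for t
    by (simp_all add: S_def skew_point_def)
  have split: "contour_integral (linepath a b) g = f 0 * contour_integral (linepath a b) (\<lambda>z. 1 /
      z) + (H b - H a)"
    if ab: "a \<in> S" "b \<in> S" "0 \<notin> closed_segment a b" for a b
  proof -
    have sub: "closed_segment a b \<subseteq> S" using ab S(1) by (simp add: closed_segment_subset)
    have i1: "(\<lambda>z. 1 / z) contour_integrable_on linepath a b"
      using ab(3) by (intro contour_integrable_continuous_linepath continuous_intros) auto
    have "contour_integral (linepath a b) g = contour_integral (linepath a b) (\<lambda>z. f 0 * (1 / z) + h z)"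
    proof (rule contour_integral_eq)
      fix z assume "z \<in> path_image (linepath a b)"
      then have "z \<in> S" "z \<noteq> 0" using sub ab(3) by auto
      then show "g z = f 0 * (1 / z) + h z" by (rule g_eq)
    qed
    also have "\<dots> = f 0 * contour_integral (linepath a b) (\<lambda>z. 1 / z) + contour_integral
        (linepath a b) h"
      using i1 has_contour_integral_integrable[OF H[OF ab(1,2)]]
      by (simp only: contour_integral_add contour_integral_lmul contour_integrable_lmul)
    finally show ?thesis using contour_integral_unique[OF H[OF ab(1,2)]] by simp
  qed
  let ?hor = "\<lambda>s T. contour_integral (linepath (skew_point (- (1/2)) (s * T)) (skew_point (1/2) (s
      * T))) g"
  have hor0: "((\<lambda>T. ?hor s T) \<longlongrightarrow> 0) at_top" if "\<bar>s\<bar> = 1" for s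
  proof (rule horizontal_integral_tendsto_0[OF A that, where C="2 * norm C" and \<beta>=\<beta>])
    fix u t :: real assume "\<bar>t\<bar> \<ge> 1"
    then have e: "norm (exp (2 * of_real pi * \<i> * skew_point u t) - 1) \<ge> 1 / 2" (is "?e \<ge> _")
      by (rule norm_exp_minus_1_ge)
    then have "inverse ?e \<le> inverse (1 / 2)" by (intro le_imp_inverse_le) auto
    then have "norm (C * gauss_kernel A \<beta> (skew_point u t)) * inverse ?e
        \<le> norm (C * gauss_kernel A \<beta> (skew_point u t)) * 2"
      by (intro mult_left_mono) auto
    then show "norm (g (skew_point u t)) \<le> 2 * norm C * norm (gauss_kernel A \<beta> (skew_point u t))"
      unfolding g_def norm_divide by (simp add: divide_inverse norm_mult mult_ac)
  qed
  have eq: "skew_integral g (1/2) T - skew_integral g (- (1/2)) T = C + ?hor 1 T - ?hor (-1) T" if T: "T > 0" for T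
  proof -
    have vert: "0 \<notin> closed_segment (skew_point x (-T)) (skew_point x T)" if "x \<noteq> 0" for x
      using closed_segment_skew[of 0 x "-T" T] that by auto
    have horz: "0 \<notin> closed_segment (skew_point (- (1/2)) t) (skew_point (1/2) t)" if "t \<noteq> 0" for t
      using closed_segment_horizontal[of 0] that
      by (metis complex.sel(2) skew_point_def zero_complex.sel(2))
    have "skew_integral g (1/2) T - skew_integral g (- (1/2)) T
      = f 0 * (skew_integral (\<lambda>z. 1 / z) (1/2) T - skew_integral (\<lambda>z. 1 / z) (- (1/2)) T)
        + (H (skew_point (1/2) T) - H (skew_point (1/2) (-T))) - (H (skew_point (- (1/2)) T) - H
            (skew_point (- (1/2)) (-T)))"
      using vert pS unfolding skew_integral_def by (simp add: split right_diff_distrib)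
    also have "\<dots> = f 0 * (2 * of_real pi * \<i>) + ?hor 1 T - ?hor (-1) T"
      unfolding skew_residue_inverse[OF T] using T horz pS by (simp add: split distrib_left right_diff_distrib)
    finally show ?thesis by (simp add: f0)
  qed
  have "((\<lambda>T. C + ?hor 1 T - ?hor (-1) T) \<longlongrightarrow> C + 0 - 0) at_top"
    by (intro tendsto_intros hor0) simp_all
  moreover have "\<forall>\<^sub>F T in at_top. C + ?hor 1 T - ?hor (-1) T = skew_integral g (1/2) T -
      skew_integral g (- (1/2)) T"
    using eventually_gt_at_top[of 0] by eventually_elim (simp add: eq)
  ultimately show ?thesis using Lim_transform_eventually by fastforce
qed

lemma exp_ne_1_half_line:
  assumes "Re z - Im z = - (1/2)"
  shows "exp (2 * of_real pi * \<i> * z) \<noteq> 1"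
proof
  assume "exp (2 * of_real pi * \<i> * z) = 1"
  then have "z = 0" using assms by (intro exp_2pi_eq_1_skew) simp_all
  with assms show False by simp
qed

lemma gauss_kernel_shift:
  "gauss_kernel A \<beta> (z + of_real x) = gauss_kernel A \<beta> (of_real x) * gauss_kernel A (\<beta> +
      A * x) z"
proof -
  have "\<i> * of_real pi * of_real A * (z + of_real x)\<^sup>2 + 2 * \<i> * of_real pi * of_real \<beta> *
      (z + of_real x) =
    (\<i> * of_real pi * of_real A * (of_real x)\<^sup>2 + 2 * \<i> * of_real pi * of_real \<beta> * of_real x) +
    (\<i> * of_real pi * of_real A * z\<^sup>2 + 2 * \<i> * of_real pi * of_real (\<beta> + A * x) * z)"
    by (simp add: power2_eq_square algebra_simps)
  then show ?thesis unfolding gauss_kernel_def by (simp only: exp_add)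
qed

lemma exp_2pi_int: "exp (2 * of_real pi * \<i> * of_int n) = 1"
  using exp_integer_2pi[of "of_int n"] by (simp add: mult_ac)

text \<open>
  Shifting the line by 1 picks up the residue \<open>\<phi> l\<close> at an integer \<open>l\<close>.  Over
      \<open>c\<close> shifts the left-hand side
  appears, while \<open>\<phi> (z + c) = \<phi> z * exp (2\<pi>iaz)\<close> makes the difference of the
      outermost integrands a finite
  geometric sum of quadratic exponentials.
\<close>

lemma gauss_sum_reciprocity:
  fixes a c :: nat and b :: int
  assumes a: "a > 0" and c: "c > 0" and ev: "even (a * c)"
  shows "(\<Sum>l<c. exp (\<i> * of_real pi * of_real ((of_nat a * of_nat l ^ 2 + 2 * of_int b * of_nat l)
      / of_nat c))) =
    of_real (sqrt (of_nat c / (2 * of_nat a))) * (1 + \<i>) *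
    (\<Sum>n<a. exp (- \<i> * of_real pi * of_real ((of_int b + of_nat n * of_nat c)\<^sup>2 / (of_nat a *
        of_nat c))))"
proof -
  define A where "A = real a / real c"
  define \<beta> where "\<beta> = of_int b / real c"
  have A: "A > 0" using a c by (simp add: A_def)
  define \<phi> where "\<phi> = gauss_kernel A \<beta>"
  define g where "g z = \<phi> z / (exp (2 * of_real pi * \<i> * z) - 1)" for z
  let ?I = "\<lambda>x T. skew_integral g x T"
  have "((\<lambda>T. ?I (real (Suc l) - 1/2) T - ?I (real l - 1/2) T) \<longlongrightarrow> \<phi> (of_nat
      l)) at_top" for l
  proof -
    have "g (z + of_real (real l)) = \<phi> (of_nat l) * gauss_kernel A (\<beta> + A * l) z / (exp (2 *
        of_real pi * \<i> * z) - 1)" for z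
    proof -
      have "exp (2 * of_real pi * \<i> * (z + of_real (real l))) = exp (2 * of_real pi * \<i> * z)"
        using exp_2pi_int[of "int l"] by (simp add: distrib_left exp_add)
      then show ?thesis unfolding g_def \<phi>_def gauss_kernel_shift by simp
    qed
    moreover have "real (Suc l) - 1/2 = 1/2 + real l" "real l - 1/2 = - (1/2) + real l" by simp_all
    then have "?I (real (Suc l) - 1/2) T = skew_integral (\<lambda>z. g (z + of_real (real l))) (1/2) T"
      "?I (real l - 1/2) T = skew_integral (\<lambda>z. g (z + of_real (real l))) (- (1/2)) T" for T
      by (simp_all only: skew_integral_translate)
    ultimately show ?thesis
      using skew_integral_residue[OF A, of "\<phi> (of_nat l)" "\<beta> + A * l"] by simp
  qed
  then have "((\<lambda>T. \<Sum>l<c. ?I (real (Suc l) - 1/2) T - ?I (real l - 1/2) T)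
      \<longlongrightarrow> (\<Sum>l<c. \<phi> (of_nat l))) at_top"
    by (rule tendsto_sum)
  then have lim1: "((\<lambda>T. ?I (real c - 1/2) T - ?I (- (1/2)) T) \<longlongrightarrow> (\<Sum>l<c.
      \<phi> (of_nat l))) at_top"
    unfolding sum_lessThan_telescope[of "\<lambda>l. ?I (real l - 1/2) _"] by simp
  have "?I (real c - 1/2) T - ?I (- (1/2)) T = (\<Sum>n<a. skew_integral (gauss_kernel A (\<beta> + n)) (-
      (1/2)) T)" for T
  proof -
    let ?p = "linepath (skew_point (- (1/2)) (- T)) (skew_point (- (1/2)) T)"
    have ne: "exp (2 * of_real pi * \<i> * z) \<noteq> 1"
      if "z \<in> closed_segment (skew_point (- (1/2)) (- T)) (skew_point (- (1/2)) T)" for z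
      using closed_segment_skew[OF that] by (rule exp_ne_1_half_line)
    have gc: "g (z + of_real (real c)) = \<phi> z * exp (2 * of_real pi * \<i> * z) ^ a / (exp (2 * of_real
        pi * \<i> * z) - 1)" for z
    proof -
      have "exp (2 * of_real pi * \<i> * (z + of_real (real c))) = exp (2 * of_real pi * \<i> * z)"
        using exp_2pi_int[of "int c"] by (simp add: distrib_left exp_add)
      moreover have "\<phi> (z + of_real (real c)) = \<phi> z * exp (2 * of_real pi * \<i> * z) ^ a"
      proof -
        obtain d where d: "a * c = 2 * d" using ev by (rule evenE)
        have e: "complex_of_real A * of_nat c = of_nat a" "complex_of_real \<beta> * of_nat c = of_int b"
          using c by (simp_all add: A_def \<beta>_def)
        have e2: "of_nat a * of_nat c = (2 * of_nat d :: complex)"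
          using d by (metis of_nat_mult of_nat_numeral)
        have "\<phi> (z + of_real (real c)) = exp (\<i> * pi * A * z\<^sup>2 + 2 * \<i> * pi * \<beta> * z
           + (2 * \<i> * pi * z * (of_real A * of_nat c) + \<i> * pi * ((of_real A * of_nat c) * of_nat c)
               + 2 * \<i> * pi * (of_real \<beta> * of_nat c)))"
          by (simp add: \<phi>_def gauss_kernel_def power2_eq_square algebra_simps)
        also have "\<dots> = \<phi> z * exp (2 * \<i> * pi * z * (of_real A * of_nat c) + \<i> * pi *
            ((of_real A * of_nat c) * of_nat c) + 2 * \<i> * pi * (of_real \<beta> * of_nat c))"
          unfolding \<phi>_def gauss_kernel_def by (rule exp_add)
        also have "2 * \<i> * pi * z * (of_real A * of_nat c) + \<i> * pi * ((of_real A * of_nat c) *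
            of_nat c) + 2 * \<i> * pi * (of_real \<beta> * of_nat c)
            = of_nat a * (2 * of_real pi * \<i> * z) + 2 * of_real pi * \<i> * of_int (int d + b)"
          unfolding e e2 by (simp add: algebra_simps)
        also have "exp \<dots> = exp (2 * of_real pi * \<i> * z) ^ a"
          unfolding exp_add exp_2pi_int exp_of_nat_mult by simp
        finally show ?thesis .
      qed
      ultimately show ?thesis by (simp add: g_def)
    qed
    have cont: "continuous_on X \<phi>" "continuous_on X (gauss_kernel A x)" for X x
      unfolding \<phi>_def by (auto intro: holomorphic_on_imp_continuous_on gauss_kernel_holomorphic)
    have "?I (real c - 1/2) T - ?I (- (1/2)) T =
        contour_integral ?p (\<lambda>z. g (z + of_real (real c))) - contour_integral ?p g"
      using skew_integral_translate[of g "- (1/2)" "real c"] by (simp add: skew_integral_def algebra_simps)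
    also have "\<dots> = contour_integral ?p (\<lambda>z. g (z + of_real (real c)) - g z)"
      unfolding gc unfolding g_def
      by (intro contour_integral_diff[symmetric] contour_integrable_continuous_linepath continuous_intros
          cont) (use ne in auto)
    also have "\<dots> = contour_integral ?p (\<lambda>z. \<Sum>n<a. gauss_kernel A (\<beta> + n) z)"
    proof (rule contour_integral_eq)
      fix z assume "z \<in> path_image ?p"
      then have nz: "exp (2 * of_real pi * \<i> * z) \<noteq> 1" using ne by simp
      have "gauss_kernel A (\<beta> + n) z = \<phi> z * exp (2 * of_real pi * \<i> * z) ^ n" for n :: nat
        by (simp add: \<phi>_def gauss_kernel_def exp_of_nat_mult[symmetric] exp_add[symmetric] algebra_simps)
      then have "(\<Sum>n<a. gauss_kernel A (\<beta> + n) z) = \<phi> z * ((exp (2 * of_real pi * \<i> * z)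
          ^ a - 1) / (exp (2 * of_real pi * \<i> * z) - 1))"
        using geometric_sum[OF nz, of a] by (simp only: sum_distrib_left[symmetric])
      then show "g (z + of_real (real c)) - g z = (\<Sum>n<a. gauss_kernel A (\<beta> + n) z)"
        unfolding gc by (simp add: g_def diff_divide_distrib right_diff_distrib)
    qed
    also have "\<dots> = (\<Sum>n<a. contour_integral ?p (gauss_kernel A (\<beta> + n)))"
      by (intro contour_integral_sum contour_integrable_continuous_linepath cont) auto
    finally show ?thesis by (simp add: skew_integral_def)
  qed
  moreover have "((\<lambda>T. \<Sum>n<a. skew_integral (gauss_kernel A (\<beta> + n)) (- (1/2)) T)
      \<longlongrightarrow>
     (\<Sum>n<a. exp (- \<i> * of_real pi * of_real ((\<beta> + n)\<^sup>2 / A)) * (of_real (1 / sqrt (2 *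
         A)) * (1 + \<i>)))) at_top"
    by (intro tendsto_sum skew_integral_gauss A)
  ultimately have main: "(\<Sum>l<c. \<phi> (of_nat l)) =
      (\<Sum>n<a. exp (- \<i> * of_real pi * of_real ((\<beta> + n)\<^sup>2 / A)) * (of_real (1 / sqrt (2 *
          A)) * (1 + \<i>)))"
    using tendsto_unique[OF _ lim1] by simp
  have ph: "\<phi> (of_nat l) = exp (\<i> * of_real pi * of_real ((of_nat a * of_nat l ^ 2 + 2 * of_int b *
      of_nat l) / of_nat c))" for l
  proof -
    have "(of_nat a * of_nat l ^ 2 + 2 * of_int b * of_nat l) / of_nat c = A * (real l)\<^sup>2 + 2 *
        \<beta> * real l"
      by (simp add: A_def \<beta>_def add_divide_distrib)
    moreover have "\<i> * of_real pi * of_real A * (of_nat l)\<^sup>2 + 2 * \<i> * of_real pi * of_real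
        \<beta> * of_nat l
      = \<i> * of_real pi * of_real (A * (real l)\<^sup>2 + 2 * \<beta> * real l)"
      by (simp add: algebra_simps)
    ultimately show ?thesis by (simp only: \<phi>_def gauss_kernel_def)
  qed
  have sq: "(\<beta> + n)\<^sup>2 / A = (of_int b + of_nat n * of_nat c)\<^sup>2 / (of_nat a * of_nat c)"
      for n :: nat
    using a c by (simp add: A_def \<beta>_def field_simps power2_eq_square)
  have rt: "1 / sqrt (2 * A) = sqrt (of_nat c / (2 * of_nat a))"
    by (simp add: A_def real_sqrt_divide)
  show ?thesis
    using main unfolding ph sq rt sum_distrib_right[symmetric] by (simp only: mult.commute)
qed

section \<open>Sums over residue classes\<close>

lemma sum_mult_coprime_moduli:
  fixes f g :: "int \<Rightarrow> complex" and a b :: int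
  assumes "a > 0" "b > 0" "coprime a b"
    and f: "\<And>x y. f (x + a * y) = f x" and g: "\<And>x y. g (x + b * y) = g x"
  shows "(\<Sum>i\<in>{0..<a}. f i) * (\<Sum>j\<in>{0..<b}. g j) = (\<Sum>n\<in>{0..<a * b}. f n * g n)"
proof -
  let ?h = "\<lambda>n. (n mod a, n mod b)"
  have fm: "f (n mod a) = f n" and gm: "g (n mod b) = g n" for n
    using f[of "n mod a" "n div a"] g[of "n mod b" "n div b"] by (simp_all add: add.commute)
  have inj: "inj_on ?h {0..<a * b}"
  proof (rule inj_onI)
    fix x y assume xy: "x \<in> {0..<a * b}" "y \<in> {0..<a * b}" "?h x = ?h y"
    then have "a dvd x - y" "b dvd x - y" by (auto simp: mod_eq_dvd_iff)
    then have "a * b dvd x - y" using assms(3) by (rule divides_mult)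
    then have "x mod (a * b) = y mod (a * b)" by (simp add: mod_eq_dvd_iff)
    then show "x = y" using xy by simp
  qed
  have "?h ` {0..<a * b} = {0..<a} \<times> {0..<b}"
  proof (rule card_subset_eq)
    show "?h ` {0..<a * b} \<subseteq> {0..<a} \<times> {0..<b}" using assms by auto
    show "card (?h ` {0..<a * b}) = card ({0..<a} \<times> {0..<b})"
      using assms by (simp add: card_image[OF inj] card_cartesian_product nat_mult_distrib)
  qed simp
  then have bij: "bij_betw ?h {0..<a * b} ({0..<a} \<times> {0..<b})"
    using inj by (simp add: bij_betw_def)
  have "(\<Sum>i\<in>{0..<a}. f i) * (\<Sum>j\<in>{0..<b}. g j) = (\<Sum>p\<in>{0..<a} \<times> {0..<b}. f
      (fst p) * g (snd p))"
    by (simp add: sum_product sum.cartesian_product case_prod_beta)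
  also have "\<dots> = (\<Sum>n\<in>{0..<a * b}. f (n mod a) * g (n mod b))"
    by (simp add: sum.reindex_bij_betw[OF bij, symmetric])
  finally show ?thesis by (simp add: fm gm)
qed

lemma sum_residue_blocks:
  fixes F :: "int \<Rightarrow> complex" and p q :: int
  assumes "p > 0" "q > 0"
  shows "(\<Sum>m\<in>{0..<p}. \<Sum>n\<in>{0..<q}. F (m + p * n)) = (\<Sum>x\<in>{0..<p * q}. F x)"
proof -
  have upper: "m + p * n < p * q" if "m < p" "n < q" for m n
  proof -
    have "p * (n + 1) \<le> p * q" using that assms by (intro mult_left_mono) auto
    then show ?thesis using that by (simp add: distrib_left)
  qed
  have "x div p < q" if "x < p * q" for x
  proof (rule ccontr)
    assume "\<not> x div p < q"
    then have "p * q \<le> p * (x div p)" using assms by (intro mult_left_mono) auto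
    also have "\<dots> \<le> x" using assms(1) mult_div_mod_eq[of p x] pos_mod_sign[of p x] by linarith
    finally show False using that by simp
  qed
  then show ?thesis
    using assms upper unfolding sum.cartesian_product
    by (intro sum.reindex_bij_witness[where i="\<lambda>x. (x mod p, x div p)" and j="\<lambda>(m, n). m + p * n"])
      (auto simp: pos_imp_zdiv_nonneg_iff)
qed

lemma sum_residues_reflect:
  fixes F :: "int \<Rightarrow> complex"
  assumes "p > 0" and per: "\<And>x y. F (x + p * y) = F x"
  shows "(\<Sum>x\<in>{0..<p}. F (- x)) = (\<Sum>x\<in>{0..<p}. F x)"
proof -
  have Fm: "F (x mod p) = F x" for x
    using per[of "x mod p" "x div p"] by (simp add: add.commute)
  have "(\<Sum>x\<in>{0..<p}. F x) = (\<Sum>x\<in>{0..<p}. F ((- x) mod p))"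
    using assms(1)
    by (intro sum.reindex_bij_witness[where i="\<lambda>x. (- x) mod p" and j="\<lambda>x. (- x) mod p"])
      (auto simp: mod_minus_eq)
  then show ?thesis by (simp add: Fm)
qed

text \<open>
  All summands below vanish at the multiples of \<open>k\<close> because their denominators do (\<open>x /
      0 = 0\<close>),
  so the sums may be taken over full residue systems.
\<close>

lemma coset_sum_residues:
  fixes f :: "int \<Rightarrow> complex" and k :: nat
  assumes "P > 0" "int k dvd P"
    and per: "\<And>x y. f (x + P * y) = f x" and zero: "\<And>x. int k dvd x \<Longrightarrow> f x = 0"
  shows "coset_sum {m. \<not> int k dvd m} (range (\<lambda>x. P * x)) f = (\<Sum>x\<in>{0..<P}. f x)"
proof -
  have "coset_sum {m. \<not> int k dvd m} (range (\<lambda>x. P * x)) f = (\<Sum>x\<in>{x\<in>{0..<P}.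
      \<not> int k dvd x}. f x)"
  proof (rule coset_sum_transversal)
    show "0 \<in> range (\<lambda>x. P * x)" by (auto intro: image_eqI[of _ _ 0])
    show "a - b \<in> range (\<lambda>x. P * x)" if "a \<in> range (\<lambda>x. P * x)" "b \<in> range
        (\<lambda>x. P * x)" for a b
      using that by (auto simp flip: right_diff_distrib)
    show "f x = f y" if "x - y \<in> range (\<lambda>x. P * x)" for x y
      using that per[of y] by (metis add.commute diff_add_cancel rangeE)
    fix x assume x: "x \<in> {m. \<not> int k dvd m}"
    have "\<not> int k dvd x mod P" using x assms(2) by (simp add: dvd_mod_iff)
    moreover have "x - x mod P \<in> range (\<lambda>x. P * x)"
      by (rule range_eqI[of _ _ "x div P"]) (simp add: minus_mod_eq_mult_div)
    moreover have "r = x mod P" if "0 \<le> r" "r < P" "x - r \<in> range (\<lambda>x. P * x)" for r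
    proof -
      have "P dvd x - r" using that(3) by auto
      then have "x mod P = r mod P" by (simp add: mod_eq_dvd_iff)
      then show ?thesis using that by simp
    qed
    ultimately show "\<exists>!r. r \<in> {x \<in> {0..<P}. \<not> int k dvd x} \<and> x - r \<in> range
        (\<lambda>x. P * x)"
      using assms(1) by (intro ex1I[of _ "x mod P"]) auto
  qed auto
  also have "\<dots> = (\<Sum>x\<in>{0..<P}. f x)"
    using zero by (intro sum.mono_neutral_left) auto
  finally show ?thesis .
qed

lemma zeta_add: "zeta k (a + b) = zeta k a * zeta k b"
  by (simp add: zeta_def add_divide_distrib distrib_left exp_add)

lemma zeta_power_int: "zeta k a powi n = zeta k (of_int n * a)"
  by (simp add: zeta_def exp_power_int mult_ac)

lemma zeta_cong:
  assumes "k > 0" "a = b + real k * of_int n"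
  shows "zeta k a = zeta k b"
proof -
  have "zeta k (real k * of_int n) = exp (2 * of_real pi * \<i> * of_int n)"
    using assms(1) by (simp add: zeta_def mult_ac)
  then show ?thesis unfolding assms(2) zeta_add by (simp add: exp_2pi_int)
qed

definition zdiff :: "nat \<Rightarrow> real \<Rightarrow> complex" where
  "zdiff k a = zeta k a - zeta k (- a)"

lemma zdiff_minus: "zdiff k (- a) = - zdiff k a"
  by (simp add: zdiff_def)

lemma zdiff_cong:
  assumes "k > 0" "a = b + real k * of_int n"
  shows "zdiff k a = zdiff k b"
  using zeta_cong[OF assms] zeta_cong[of k "- a" "- b" "- n"] assms by (simp add: zdiff_def)

lemma zdiff_eq_0:
  assumes "k > 0" "int k dvd m"
  shows "zdiff k (of_int m / 2) = 0"
proof -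
  obtain n where "m = int k * n" using assms(2) by blast
  then have "zeta k (of_int m / 2) = zeta k (- of_int m / 2)"
    using assms(1) by (intro zeta_cong[of _ _ _ n]) auto
  then show ?thesis by (simp add: zdiff_def)
qed

section \<open>The sum over a leaf\<close>

lemma sum_int_interval: "(\<Sum>x\<in>{0..<int n}. f x) = (\<Sum>l<n. f (int l))"
  by (rule sum.reindex_bij_witness[where i=int and j=nat]) auto

lemma cnj_exp_zeta: "k > 0 \<Longrightarrow> cnj (exp (\<i> * of_real pi * of_real r)) = zeta k (- (real k
    * r / 2))"
  by (simp add: zeta_def exp_cnj mult_ac)

lemma gauss_sum_zeta:
  fixes k :: nat and w b :: int
  assumes k: "k > 0" and w: "w < 0"
  shows "(\<Sum>l\<in>{0..<2 * int k}. zeta k (of_int w * of_int l ^ 2 / 4 + of_int b * of_int l / 2)) =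
    of_real (sqrt (real k / - of_int w)) * (1 - \<i>) *
    (\<Sum>n\<in>{0..<- w}. zeta k (- ((of_int b + 2 * real k * of_int n)\<^sup>2) / (4 * of_int w)))"
proof -
  define a where "a = nat (- w)"
  have a: "a > 0" "w = - int a" using w by (simp_all add: a_def)
  define F where "F n = zeta k ((of_int b + 2 * real k * of_int n)\<^sup>2 / (4 * of_nat a))" for n :: int
  have per: "F (n + int a * y) = F n" for n y
    unfolding F_def
    by (rule zeta_cong[OF k, of _ _ "y * (b + 2 * int k * n) + int k * int a * y\<^sup>2"])
      (use a in \<open>simp add: field_simps power2_eq_square\<close>)
  have eL: "cnj (exp (\<i> * of_real pi * of_real ((of_nat a * of_nat l ^ 2 + 2 * of_int (- b) * of_nat l)
      / of_nat (2 * k))))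
      = zeta k (of_int w * of_int (int l) ^ 2 / 4 + of_int b * of_int (int l) / 2)" for l :: nat
    unfolding cnj_exp_zeta[OF k] using k a(2) by (intro arg_cong[where f="zeta k"]) (simp add: field_simps)
  have eR: "cnj (exp (- \<i> * of_real pi * of_real ((of_int (- b) + of_nat n * of_nat (2 * k))\<^sup>2 /
      (of_nat a * of_nat (2 * k)))))
      = F (- int n)" for n :: nat
  proof -
    have "(of_int (- b) + of_nat n * of_nat (2 * k))\<^sup>2 = (of_int b + 2 * real k * of_int (- int n))\<^sup>2"
      by (simp add: power2_eq_square algebra_simps)
    moreover have "exp (- \<i> * of_real pi * of_real r) = exp (\<i> * of_real pi * of_real (- r))" for r
      by simp
    ultimately show ?thesis unfolding F_def using k a
      by (simp only: cnj_exp_zeta[OF k]) (intro arg_cong[where f="zeta k"], simp add: field_simps)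
  qed
  have "(\<Sum>l\<in>{0..<int (2 * k)}. zeta k (of_int w * of_int l ^ 2 / 4 + of_int b * of_int l / 2)) =
      cnj (\<Sum>l<2 * k. exp (\<i> * of_real pi * of_real ((of_nat a * of_nat l ^ 2 + 2 * of_int (- b) *
          of_nat l) / of_nat (2 * k))))"
    unfolding sum_int_interval cnj_sum eL ..
  also have "\<dots> = of_real (sqrt (of_nat (2 * k) / (2 * of_nat a))) * (1 - \<i>) * (\<Sum>n<a. F (- int n))"
  proof -
    have "2 * k > 0" "even (a * (2 * k))" using k by simp_all
    from gauss_sum_reciprocity[OF a(1) this] show ?thesis
      by (simp only: complex_cnj_mult cnj_sum eR complex_cnj_complex_of_real complex_cnj_add complex_cnj_one
        complex_cnj_i) simp
  qed
  also have "(\<Sum>n<a. F (- int n)) = (\<Sum>n\<in>{0..<int a}. F n)"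
    using sum_residues_reflect[of "int a" F] a per by (simp add: sum_int_interval)
  finally show ?thesis using a(2) by (simp add: F_def)
qed

definition leaf_term :: "nat \<Rightarrow> int \<Rightarrow> int \<Rightarrow> complex" where
  "leaf_term k w x = zeta k (- (of_int x ^ 2) / (4 * of_int w)) * zdiff k (of_int x / (2 * of_int w))"

definition leaf_const :: "nat \<Rightarrow> int \<Rightarrow> complex" where
  "leaf_const k w = - zeta k (- (of_int w + 1 / of_int w) / 4) * of_real (sqrt (real k / - of_int w)) * (1 - \<i>)"

lemma leaf_term_periodic:
  assumes "k > 0" "w \<noteq> 0"
  shows "leaf_term k w (x + 2 * int k * w * y) = leaf_term k w x"
proof -
  have "zeta k (- (of_int (x + 2 * int k * w * y) ^ 2) / (4 * of_int w)) = zeta k (- (of_int x ^ 2) / (4 *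
      of_int w))"
    by (rule zeta_cong[OF assms(1), of _ _ "- (x * y + int k * w * y\<^sup>2)"])
      (use assms in \<open>simp add: field_simps power2_eq_square\<close>)
  moreover have "zdiff k (of_int (x + 2 * int k * w * y) / (2 * of_int w)) = zdiff k (of_int x / (2 * of_int w))"
    by (rule zdiff_cong[OF assms(1), of _ _ y]) (use assms in \<open>simp add: field_simps\<close>)
  ultimately show ?thesis by (simp add: leaf_term_def)
qed

lemma leaf_sum:
  fixes k :: nat and w m :: int
  assumes k: "k > 0" and w: "w < 0"
  shows "(\<Sum>l\<in>{0..<2 * int k}. zeta k (of_int w * (of_int l ^ 2 - 1) / 4) * zdiff k (of_int l / 2) *
      (zdiff k (of_int (m * l) / 2) / 2)) =
    leaf_const k w * (\<Sum>n\<in>{0..<- w}. leaf_term k w (m + 2 * int k * n))"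
proof -
  define q where "q b l = zeta k (of_int w * of_int l ^ 2 / 4 + of_int b * of_int l / 2)" for b l :: int
  define g where "g b = (\<Sum>l\<in>{0..<2 * int k}. q b l)" for b
  have per: "q b (l + 2 * int k * y) = q b l" for b l y
    unfolding q_def by (rule zeta_cong[OF k, of _ _ "w * (l * y + int k * y\<^sup>2) + b * y"])
      (simp add: field_simps power2_eq_square)
  have g_minus: "g (- b) = g b" for b
  proof -
    have "q (- b) l = q b (- l)" for l by (simp add: q_def)
    then show ?thesis
      using sum_residues_reflect[of "2 * int k" "q b"] per k by (simp add: g_def)
  qed
  have shift: "zeta k (- ((of_int (m + 1) + 2 * real k * of_int n)\<^sup>2) / (4 * of_int w)) -
        zeta k (- ((of_int (m - 1) + 2 * real k * of_int n)\<^sup>2) / (4 * of_int w))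
     = - zeta k (- 1 / (4 * of_int w)) * leaf_term k w (m + 2 * int k * n)" for n
  proof -
    have "zeta k (- ((of_int (m + 1) + 2 * real k * of_int n)\<^sup>2) / (4 * of_int w)) =
        zeta k (- 1 / (4 * of_int w)) * (zeta k (- (of_int (m + 2 * int k * n) ^ 2) / (4 * of_int w))
          * zeta k (- (of_int (m + 2 * int k * n) / (2 * of_int w))))"
      "zeta k (- ((of_int (m - 1) + 2 * real k * of_int n)\<^sup>2) / (4 * of_int w)) =
        zeta k (- 1 / (4 * of_int w)) * (zeta k (- (of_int (m + 2 * int k * n) ^ 2) / (4 * of_int w))
          * zeta k (of_int (m + 2 * int k * n) / (2 * of_int w)))"
      unfolding zeta_add[symmetric] using w by (auto simp: field_simps power2_eq_square intro!:
          arg_cong[where f="zeta k"])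
    then show ?thesis by (simp only: leaf_term_def zdiff_def) (simp add: algebra_simps)
  qed
  have "zeta k (of_int w * (of_int l ^ 2 - 1) / 4) * zdiff k (of_int l / 2) * (zdiff k (of_int (m * l) / 2) / 2)
     = zeta k (- of_int w / 4) / 2 * (q (m + 1) l - q (1 - m) l - q (m - 1) l + q (- m - 1) l)" for l
  proof -
    have "zeta k (of_int w * (of_int l ^ 2 - 1) / 4) = zeta k (- of_int w / 4) * zeta k (of_int w * of_int
        l ^ 2 / 4)"
      by (simp add: right_diff_distrib diff_divide_distrib flip: zeta_add)
    moreover have "q (m + 1) l = zeta k (of_int w * of_int l ^ 2 / 4) * (zeta k (of_int l / 2) * zeta k
        (of_int (m * l) / 2))"
      "q (1 - m) l = zeta k (of_int w * of_int l ^ 2 / 4) * (zeta k (of_int l / 2) * zeta k (- (of_int (m *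
          l) / 2)))"
      "q (m - 1) l = zeta k (of_int w * of_int l ^ 2 / 4) * (zeta k (- (of_int l / 2)) * zeta k (of_int (m
          * l) / 2))"
      "q (- m - 1) l = zeta k (of_int w * of_int l ^ 2 / 4) * (zeta k (- (of_int l / 2)) * zeta k (-
          (of_int (m * l) / 2)))"
      unfolding q_def zeta_add[symmetric] by (simp_all add: field_simps)
    moreover have "c * u * (x - y) * ((p - r) / 2) =
        c / 2 * (u * (x * p) - u * (x * r) - u * (y * p) + u * (y * r))" for c u x y p r :: complex
      by (simp add: field_simps)
    ultimately show ?thesis by (simp only: zdiff_def)
  qed
  then have "(\<Sum>l\<in>{0..<2 * int k}. zeta k (of_int w * (of_int l ^ 2 - 1) / 4) * zdiff k (of_int l / 2) *
      (zdiff k (of_int (m * l) / 2) / 2)) = zeta k (- of_int w / 4) / 2 * (g (m + 1) - g (1 - m) - g (m -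
          1) + g (- m - 1))"
    by (simp only: g_def sum_distrib_left[symmetric] sum.distrib sum_subtractf)
  also have "\<dots> = zeta k (- of_int w / 4) * (g (m + 1) - g (m - 1))"
    using g_minus[of "m - 1"] g_minus[of "m + 1"] by simp
  also have "g (m + 1) - g (m - 1) = of_real (sqrt (real k / - of_int w)) * (1 - \<i>) *
     (\<Sum>n\<in>{0..<- w}. - zeta k (- 1 / (4 * of_int w)) * leaf_term k w (m + 2 * int k * n))"
    unfolding g_def q_def gauss_sum_zeta[OF k w] shift[symmetric] by (simp only: sum_subtractf right_diff_distrib)
  also have "zeta k (- of_int w / 4) * (of_real (sqrt (real k / - of_int w)) * (1 - \<i>) *
      (\<Sum>n\<in>{0..<- w}. - zeta k (- 1 / (4 * of_int w)) * leaf_term k w (m + 2 * int k * n))) =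
     leaf_const k w * (\<Sum>n\<in>{0..<- w}. leaf_term k w (m + 2 * int k * n))"
  proof -
    have "zeta k (- (of_int w + 1 / of_int w) / 4) = zeta k (- of_int w / 4) * zeta k (- 1 / (4 * of_int w))"
      unfolding zeta_add[symmetric] by (simp add: field_simps)
    then show ?thesis unfolding leaf_const_def by (simp add: sum_negf sum_distrib_left[symmetric])
  qed
  finally show ?thesis .
qed

lemma leaf_pair_sum:
  fixes k :: nat and w w' :: int
  assumes k: "k > 0" and w: "w < 0" "w' < 0" and cop: "coprime w w'"
    and h: "\<And>x y. h (x + 2 * int k * y) = h x"
  shows "(\<Sum>m\<in>{0..<2 * int k}. h m * (leaf_const k w * (\<Sum>n\<in>{0..<- w}. leaf_term k w (m + 2
      * int k * n))) *
      (leaf_const k w' * (\<Sum>n\<in>{0..<- w'}. leaf_term k w' (m + 2 * int k * n)))) =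
    leaf_const k w * leaf_const k w' * (\<Sum>x\<in>{0..<2 * int k * (w * w')}. h x * leaf_term k w x *
        leaf_term k w' x)"
proof -
  let ?t = "leaf_term k w" and ?t' = "leaf_term k w'"
  have per: "leaf_term k v (m + 2 * int k * (x + - v * y)) = leaf_term k v (m + 2 * int k * x)" if "v < 0"
      for v m x y
    using leaf_term_periodic[OF k, of v "m + 2 * int k * x" "- y"] that by (simp add: algebra_simps)
  have prod: "(\<Sum>n\<in>{0..<- w}. ?t (m + 2 * int k * n)) * (\<Sum>n\<in>{0..<- w'}. ?t' (m + 2 * int k * n)) =
      (\<Sum>n\<in>{0..<w * w'}. ?t (m + 2 * int k * n) * ?t' (m + 2 * int k * n))" for m
    using sum_mult_coprime_moduli[of "- w" "- w'" "\<lambda>n. ?t (m + 2 * int k * n)" "\<lambda>n. ?t' (m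
        + 2 * int k * n)"]
      w cop per by simp
  have "(\<Sum>m\<in>{0..<2 * int k}. h m * (leaf_const k w * (\<Sum>n\<in>{0..<- w}. ?t (m + 2 * int k * n))) *
      (leaf_const k w' * (\<Sum>n\<in>{0..<- w'}. ?t' (m + 2 * int k * n)))) =
    leaf_const k w * leaf_const k w' * (\<Sum>m\<in>{0..<2 * int k}. h m * (\<Sum>n\<in>{0..<w * w'}. ?t (m
        + 2 * int k * n) * ?t' (m + 2 * int k * n)))"
    unfolding prod[symmetric] sum_distrib_left[of "leaf_const k w * leaf_const k w'"]
    by (intro sum.cong) (simp_all only: mult_ac)
  also have "(\<Sum>m\<in>{0..<2 * int k}. h m * (\<Sum>n\<in>{0..<w * w'}. ?t (m + 2 * int k * n) * ?t' (m
      + 2 * int k * n))) =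
     (\<Sum>m\<in>{0..<2 * int k}. \<Sum>n\<in>{0..<w * w'}. (\<lambda>x. h x * ?t x * ?t' x) (m + 2 * int k * n))"
    by (simp only: sum_distrib_left h mult.assoc[of "h m" for m])
  also have "\<dots> = (\<Sum>x\<in>{0..<2 * int k * (w * w')}. h x * ?t x * ?t' x)"
    using k w by (intro sum_residue_blocks) (auto simp: mult_neg_neg)
  finally show ?thesis .
qed

section \<open>The surgery formula as a double sum\<close>

lemma exhaust_6:
  fixes x :: 6
  shows "x = 1 \<or> x = 2 \<or> x = 3 \<or> x = 4 \<or> x = 5 \<or> x = 6"
proof (induct x)
  case (of_int z)
  then have "z = 0 \<or> z = 1 \<or> z = 2 \<or> z = 3 \<or> z = 4 \<or> z = 5" by fastforce
  then show ?case by auto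
qed

lemma UNIV_6: "UNIV = {1, 2, 3, 4, 5, 6 :: 6}"
  using exhaust_6 by auto

lemma forall_6: "(\<forall>i::6. P i) \<longleftrightarrow> P 1 \<and> P 2 \<and> P 3 \<and> P 4 \<and> P 5
    \<and> P 6"
  by (metis exhaust_6)

lemma sum_6: "sum f (UNIV :: 6 set) = f 1 + f 2 + f 3 + f 4 + f 5 + f 6"
  unfolding UNIV_6 by (simp add: add.assoc)

lemma prod_6: "prod f (UNIV :: 6 set) = f 1 * f 2 * f 3 * f 4 * f 5 * f 6"
  unfolding UNIV_6 by (simp add: mult.assoc)

lemma H_degree_eq:
  "H_degree 1 = 3" "H_degree 2 = 3" "H_degree 3 = 1" "H_degree 4 = 1" "H_degree 5 = 1" "H_degree 6 = 1"
proof -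
  have "{v'. {1, v'} \<in> H_edges} = {2, 3, 4}" "{v'. {2, v'} \<in> H_edges} = {1, 5, 6}"
    "{v'. {3, v'} \<in> H_edges} = {1}" "{v'. {4, v'} \<in> H_edges} = {1}"
    "{v'. {5, v'} \<in> H_edges} = {2}" "{v'. {6, v'} \<in> H_edges} = {2}"
    by (auto simp: H_edges_def doubleton_eq_iff)
  then show "H_degree 1 = 3" "H_degree 2 = 3" "H_degree 3 = 1" "H_degree 4 = 1" "H_degree 5 = 1" "H_degree 6 = 1"
    by (simp_all add: H_degree_def)
qed

lemma prod_H_edges: "prod f H_edges = f {1,2} * f {1,3} * f {1,4} * f {2,5} * f {2,6}"
  by (simp add: H_edges_def doubleton_eq_iff mult.assoc)

definition vec6 :: "'a \<Rightarrow> 'a \<Rightarrow> 'a \<Rightarrow> 'a \<Rightarrow> 'a \<Rightarrow> 'a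
    \<Rightarrow> 'a ^ 6" where
  "vec6 a b c d e f = (\<chi> i. if i = 1 then a else if i = 2 then b else if i = 3 then c
     else if i = 4 then d else if i = 5 then e else f)"

lemma vec6_nth [simp]:
  "vec6 a b c d e f $ 1 = a" "vec6 a b c d e f $ 2 = b" "vec6 a b c d e f $ 3 = c"
  "vec6 a b c d e f $ 4 = d" "vec6 a b c d e f $ 5 = e" "vec6 a b c d e f $ 6 = f"
  by (simp_all add: vec6_def)

lemma vec6_eta [simp]: "vec6 (a $ 1) (a $ 2) (a $ 3) (a $ 4) (a $ 5) (a $ 6) = a"
  by (simp add: vec_eq_iff forall_6)

lemma sum_vectors_6:
  "(\<Sum>l\<in>{l :: 'a ^ 6. \<forall>v. l $ v \<in> A}. F l) =
    (\<Sum>a\<in>A. \<Sum>b\<in>A. \<Sum>c\<in>A. \<Sum>d\<in>A. \<Sum>e\<in>A. \<Sum>f\<in>A. F (vec6 a b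
        c d e f))"
  unfolding sum.cartesian_product
  by (rule sum.reindex_bij_witness[where j="\<lambda>l. (l$1, l$2, l$3, l$4, l$5, l$6)"
        and i="\<lambda>(a, b, c, d, e, f). vec6 a b c d e f"])
    (auto simp: vec_eq_iff forall_6)

lemma coset_sum_vectors:
  fixes F :: "int ^ 'n \<Rightarrow> complex" and k :: nat
  assumes k: "k > 0"
    and inv: "\<And>l l'. (\<And>v. \<exists>y. l $ v = l' $ v + 2 * int k * y) \<Longrightarrow> F l = F l'"
    and zero: "\<And>l v. int k dvd l $ v \<Longrightarrow> F l = 0"
  shows "coset_sum {l. \<forall>v. \<not> int k dvd l $ v} (range (\<lambda>x. \<chi> v. 2 * int k * x $ v)) F =
    (\<Sum>l\<in>{l. \<forall>v. l $ v \<in> {0..<2 * int k}}. F l)"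
proof -
  let ?L = "range (\<lambda>x :: int ^ 'n. \<chi> v. 2 * int k * x $ v)"
  let ?X = "{l :: int ^ 'n. \<forall>v. \<not> int k dvd l $ v}"
  let ?B = "{l :: int ^ 'n. \<forall>v. l $ v \<in> {0..<2 * int k}}"
  have L: "z \<in> ?L \<longleftrightarrow> (\<forall>v. 2 * int k dvd z $ v)" for z
  proof
    assume z: "\<forall>v. 2 * int k dvd z $ v"
    have "z = (\<chi> v. 2 * int k * (\<chi> v. z $ v div (2 * int k)) $ v)"
      using z by (simp add: vec_eq_iff)
    then show "z \<in> ?L" by blast
  qed auto
  have "coset_sum ?X ?L F = (\<Sum>l\<in>?B \<inter> ?X. F l)"
  proof (rule coset_sum_transversal)
    show "0 \<in> ?L" by (simp add: L)
    show "a - b \<in> ?L" if "a \<in> ?L" "b \<in> ?L" for a b using that by (simp add: L)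
    show "F x = F y" if "x - y \<in> ?L" for x y
    proof (rule inv)
      fix v
      have "2 * int k dvd x $ v - y $ v" using that by (simp add: L)
      then show "\<exists>z. x $ v = y $ v + 2 * int k * z" by (metis add.commute diff_add_cancel dvdE)
    qed
    fix x assume x: "x \<in> ?X"
    let ?r = "\<chi> v. x $ v mod (2 * int k)"
    have "?r \<in> ?B \<inter> ?X" using x k by (simp add: dvd_mod_iff)
    moreover have "x - ?r \<in> ?L" by (simp add: L minus_mod_eq_mult_div)
    moreover have "r = ?r" if r: "r \<in> ?B \<inter> ?X" "x - r \<in> ?L" for r
    proof -
      have "r $ v = x $ v mod (2 * int k)" for v
      proof -
        have "x $ v mod (2 * int k) = r $ v mod (2 * int k)" using r(2) by (simp add: L mod_eq_dvd_iff)
        then show ?thesis using r(1) by simp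
      qed
      then show ?thesis by (simp add: vec_eq_iff)
    qed
    ultimately show "\<exists>!r. r \<in> ?B \<inter> ?X \<and> x - r \<in> ?L" by (intro ex1I[of _ ?r]) auto
  qed auto
  also have "\<dots> = (\<Sum>l\<in>?B. F l)"
  proof (rule sum.mono_neutral_left)
    have "?B \<subseteq> (\<lambda>f. \<chi> v. f v) ` (PiE UNIV (\<lambda>_. {0..<2 * int k}))"
    proof
      fix l assume "l \<in> ?B"
      then have "($) l \<in> PiE UNIV (\<lambda>_. {0..<2 * int k})" by (auto simp: PiE_iff)
      moreover have "l = (\<chi> v. l $ v)" by (simp add: vec_eq_iff)
      ultimately show "l \<in> (\<lambda>f. \<chi> v. f v) ` (PiE UNIV (\<lambda>_. {0..<2 * int k}))"
        by (intro image_eqI[where x="($) l"]) simp_all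
    qed
    then show "finite ?B" by (rule finite_subset) (intro finite_imageI finite_PiE, auto)
    show "\<forall>l\<in>?B - ?B \<inter> ?X. F l = 0" using zero by blast
  qed blast
  finally show ?thesis .
qed

definition leaf_summand :: "nat \<Rightarrow> int \<Rightarrow> int \<Rightarrow> int \<Rightarrow> complex" where
  "leaf_summand k w m l = zeta k (of_int w * (of_int l ^ 2 - 1) / 4) * zdiff k (of_int l / 2) *
      (zdiff k (of_int (m * l) / 2) / 2)"

definition node_factor :: "nat \<Rightarrow> int \<Rightarrow> int \<Rightarrow> complex" where
  "node_factor k w m = zeta k (of_int w * (of_int m ^ 2 - 1) / 4) / zdiff k (of_int m / 2)"

lemma weight_periodic:
  assumes "k > 0"
  shows "zeta k (of_int w * (of_int (x + 2 * int k * y) ^ 2 - 1) / 4) = zeta k (of_int w * (of_int x ^ 2 - 1) / 4)"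
  by (rule zeta_cong[OF assms, of _ _ "w * (x * y + int k * y\<^sup>2)"])
    (simp add: field_simps power2_eq_square)

lemma zdiff_half_periodic:
  assumes "k > 0" "x = y + 2 * int k * z"
  shows "zdiff k (of_int x / 2) = zdiff k (of_int y / 2)"
  by (rule zdiff_cong[OF assms(1), of _ _ z]) (simp add: assms(2) field_simps)

lemma tau_double_sum:
  assumes k: "k > 0"
  shows "tau k w = - \<i> * zeta k (- 9 / 2) / (16 * of_nat k ^ 3 * (zeta (2 * k) 1 - inverse (zeta (2 * k) 1))) *
    (\<Sum>m\<in>{0..<2 * int k}. \<Sum>n\<in>{0..<2 * int k}.
      node_factor k (w $ 1) m * node_factor k (w $ 2) n * (zdiff k (of_int (m * n) / 2) / 2) *
      (\<Sum>l\<in>{0..<2 * int k}. leaf_summand k (w $ 3) m l) * (\<Sum>l\<in>{0..<2 * int k}.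
          leaf_summand k (w $ 4) m l) *
      ((\<Sum>l\<in>{0..<2 * int k}. leaf_summand k (w $ 5) n l) * (\<Sum>l\<in>{0..<2 * int k}.
          leaf_summand k (w $ 6) n l)))"
proof -
  let ?I = "{0..<2 * int k}"
  define V where "V v x = zeta k (of_int (w $ v) * (of_int x ^ 2 - 1) / 4) *
      (1 / zdiff k (of_int x / 2)) powi (int (H_degree v) - 2)" for v x
  define E where "E x = zdiff k (of_int x / 2) / 2" for x :: int
  define F where "F l = (\<Prod>v\<in>UNIV. V v (l $ v)) * (\<Prod>e\<in>H_edges. E (\<Prod>v\<in>e. l $
      v))" for l :: "int ^ 6"
  have Vper: "V v (x + 2 * int k * y) = V v x" for v x y
    unfolding V_def weight_periodic[OF k] zdiff_half_periodic[OF k refl] ..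
  have Vzero: "V v x = 0" if "int k dvd x" for v x
  proof -
    have "int (H_degree v) - 2 \<noteq> 0" using exhaust_6[of v] by (auto simp: H_degree_eq)
    then show ?thesis using zdiff_eq_0[OF k that] by (simp add: V_def)
  qed
  have "tau k w = - \<i> * zeta k (- 9 / 2) / (16 * of_nat k ^ 3 * (zeta (2 * k) 1 - inverse (zeta (2 * k) 1))) *
    coset_sum {l :: int ^ 6. \<forall>v. \<not> int k dvd l $ v} (range (\<lambda>x. \<chi> v. 2 * int k *
        x $ v)) F"
    unfolding tau_def F_def V_def E_def zdiff_def by simp
  also have "coset_sum {l :: int ^ 6. \<forall>v. \<not> int k dvd l $ v} (range (\<lambda>x. \<chi> v. 2 *
      int k * x $ v)) F =
      (\<Sum>l\<in>{l. \<forall>v. l $ v \<in> ?I}. F l)"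
  proof (rule coset_sum_vectors[OF k])
    fix l l' :: "int ^ 6" assume "\<And>v. \<exists>y. l $ v = l' $ v + 2 * int k * y"
    then obtain y where y: "\<And>v. l $ v = l' $ v + 2 * int k * y v" by metis
    have "E (\<Prod>v\<in>e. l $ v) = E (\<Prod>v\<in>e. l' $ v)" for e
    proof -
      have "[(\<Prod>v\<in>e. l $ v) = (\<Prod>v\<in>e. l' $ v)] (mod (2 * int k))"
        by (rule cong_prod) (simp add: y cong_def)
      then obtain z where "(\<Prod>v\<in>e. l $ v) = (\<Prod>v\<in>e. l' $ v) + 2 * int k * z"
        by (metis cong_iff_lin cong_sym)
      then show ?thesis unfolding E_def by (simp only: zdiff_half_periodic[OF k])
    qed
    then show "F l = F l'" by (simp add: F_def y Vper)
  next
    fix l :: "int ^ 6" and v assume "int k dvd l $ v"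
    then have "V v (l $ v) = 0" by (rule Vzero)
    then have "(\<Prod>v\<in>UNIV. V v (l $ v)) = 0" by (intro prod_zero) auto
    then show "F l = 0" by (simp add: F_def)
  qed
  also have "\<dots> = (\<Sum>m\<in>?I. \<Sum>n\<in>?I. \<Sum>a\<in>?I. \<Sum>b\<in>?I. \<Sum>c\<in>?I.
      \<Sum>d\<in>?I.
      node_factor k (w $ 1) m * node_factor k (w $ 2) n * (zdiff k (of_int (m * n) / 2) / 2) *
      leaf_summand k (w $ 3) m a * leaf_summand k (w $ 4) m b * (leaf_summand k (w $ 5) n c * leaf_summand
          k (w $ 6) n d))"
  proof -
    have "F (vec6 m n a b c d) = node_factor k (w $ 1) m * node_factor k (w $ 2) n * (zdiff k (of_int (m *
        n) / 2) / 2) *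
      leaf_summand k (w $ 3) m a * leaf_summand k (w $ 4) m b * (leaf_summand k (w $ 5) n c * leaf_summand
          k (w $ 6) n d)"
      for m n a b c d
      by (simp add: F_def V_def E_def prod_6 prod_H_edges H_degree_eq node_factor_def leaf_summand_def
          power_int_minus mult_ac)
    then show ?thesis by (simp only: sum_vectors_6)
  qed
  also have "\<dots> = (\<Sum>m\<in>?I. \<Sum>n\<in>?I.
      node_factor k (w $ 1) m * node_factor k (w $ 2) n * (zdiff k (of_int (m * n) / 2) / 2) *
      (\<Sum>l\<in>?I. leaf_summand k (w $ 3) m l) * (\<Sum>l\<in>?I. leaf_summand k (w $ 4) m l) *
      ((\<Sum>l\<in>?I. leaf_summand k (w $ 5) n l) * (\<Sum>l\<in>?I. leaf_summand k (w $ 6) n l)))"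
    by (simp only: sum_distrib_left[symmetric] sum_distrib_right[symmetric])
  finally show ?thesis .
qed

section \<open>The linking matrix\<close>

lemma matrix_inv_eqI:
  fixes A B :: "'a::field ^ 'n ^ 'n"
  assumes "A ** B = mat 1"
  shows "matrix_inv A = B"
proof -
  have BA: "B ** A = mat 1" using assms matrix_left_right_inverse by blast
  have "A ** matrix_inv A = mat 1"
    unfolding matrix_inv_def using assms BA by (rule_tac someI2[of _ B]) auto
  then have "B ** (A ** matrix_inv A) = B" by simp
  then show ?thesis unfolding matrix_mul_assoc BA by simp
qed

lemma det_add_row_multiple:
  fixes A B :: "'a::comm_ring_1 ^ 'n ^ 'n"
  assumes "i \<noteq> j" "\<forall>k. k \<noteq> i \<longrightarrow> B $ k = A $ k" "B $ i = A $ i + c *s A $ j"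
  shows "det A = det B"
proof -
  have "(\<chi> k. if k = i then row i A + c *s row j A else row k A) = B"
    using assms by (simp add: vec_eq_iff row_def)
  then show ?thesis using det_row_operation[OF assms(1), of A c] by simp
qed

definition H_matrix :: "real \<Rightarrow> real \<Rightarrow> real \<Rightarrow> real \<Rightarrow> real
    \<Rightarrow> real \<Rightarrow> real ^ 6 ^ 6" where
  "H_matrix a b c d e f = vec6 (vec6 a 1 1 1 0 0) (vec6 1 b 0 0 1 1)
     (vec6 1 0 c 0 0 0) (vec6 1 0 0 d 0 0) (vec6 0 1 0 0 e 0) (vec6 0 1 0 0 0 f)"

lemma det_H_matrix:
  assumes nz: "c \<noteq> 0" "d \<noteq> 0" "e \<noteq> 0" "f \<noteq> 0" and b': "b - 1 / e - 1 / f \<noteq> 0"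
  shows "det (H_matrix a b c d e f) = ((a - 1 / c - 1 / d) * (b - 1 / e - 1 / f) - 1) * (c * d * e * f)"
proof -
  define \<alpha> where "\<alpha> = a - 1 / c - 1 / d"
  define \<beta> where "\<beta> = b - 1 / e - 1 / f"
  define \<gamma> where "\<gamma> = \<alpha> - 1 / \<beta>"
  have \<beta>: "\<beta> \<noteq> 0" using b' by (simp add: \<beta>_def)
  let ?r3 = "vec6 1 0 c 0 0 0" and ?r4 = "vec6 1 0 0 d 0 0" and ?r5 = "vec6 0 1 0 0 e 0" and ?r6 = "vec6 0
      1 0 0 0 f"
  have "det (H_matrix a b c d e f) = det (vec6 (vec6 (a - 1 / c) 1 0 1 0 0) (vec6 1 b 0 0 1 1) ?r3 ?r4 ?r5 ?r6)"
    unfolding H_matrix_def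
    by (rule det_add_row_multiple[of 1 3 _ _ "- 1 / c"]) (use nz in \<open>simp_all add: forall_6
        vec_eq_iff\<close>)
  also have "\<dots> = det (vec6 (vec6 \<alpha> 1 0 0 0 0) (vec6 1 b 0 0 1 1) ?r3 ?r4 ?r5 ?r6)"
    by (rule det_add_row_multiple[of 1 4 _ _ "- 1 / d"]) (use nz in \<open>simp_all add: forall_6
        vec_eq_iff \<alpha>_def\<close>)
  also have "\<dots> = det (vec6 (vec6 \<alpha> 1 0 0 0 0) (vec6 1 (b - 1 / e) 0 0 0 1) ?r3 ?r4 ?r5 ?r6)"
    by (rule det_add_row_multiple[of 2 5 _ _ "- 1 / e"]) (use nz in \<open>simp_all add: forall_6
        vec_eq_iff\<close>)
  also have "\<dots> = det (vec6 (vec6 \<alpha> 1 0 0 0 0) (vec6 1 \<beta> 0 0 0 0) ?r3 ?r4 ?r5 ?r6)"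
    by (rule det_add_row_multiple[of 2 6 _ _ "- 1 / f"]) (use nz in \<open>simp_all add: forall_6
        vec_eq_iff \<beta>_def\<close>)
  also have "\<dots> = det (vec6 (vec6 \<gamma> 0 0 0 0 0) (vec6 1 \<beta> 0 0 0 0) ?r3 ?r4 ?r5 ?r6)"
    by (rule det_add_row_multiple[of 1 2 _ _ "- 1 / \<beta>"]) (use \<beta> in \<open>simp_all add:
        forall_6 vec_eq_iff \<gamma>_def\<close>)
  also have "\<dots> = \<gamma> * \<beta> * (c * d * e * f)"
  proof (cases "\<gamma> = 0")
    case True
    then show ?thesis by (simp add: det_zero_row(2)[of 1] row_def vec_eq_iff forall_6)
  next
    case False
    have "det (vec6 (vec6 \<gamma> 0 0 0 0 0) (vec6 1 \<beta> 0 0 0 0) ?r3 ?r4 ?r5 ?r6) =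
        det (vec6 (vec6 \<gamma> 0 0 0 0 0) (vec6 0 \<beta> 0 0 0 0) ?r3 ?r4 ?r5 ?r6)"
      by (rule det_add_row_multiple[of 2 1 _ _ "- 1 / \<gamma>"]) (use False in \<open>simp_all add:
          forall_6 vec_eq_iff\<close>)
    also have "\<dots> = det (vec6 (vec6 \<gamma> 0 0 0 0 0) (vec6 0 \<beta> 0 0 0 0) (vec6 0 0 c 0 0 0)
        ?r4 ?r5 ?r6)"
      by (rule det_add_row_multiple[of 3 1 _ _ "- 1 / \<gamma>"]) (use False in \<open>simp_all add:
          forall_6 vec_eq_iff\<close>)
    also have "\<dots> = det (vec6 (vec6 \<gamma> 0 0 0 0 0) (vec6 0 \<beta> 0 0 0 0) (vec6 0 0 c 0 0 0)
        (vec6 0 0 0 d 0 0) ?r5 ?r6)"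
      by (rule det_add_row_multiple[of 4 1 _ _ "- 1 / \<gamma>"]) (use False in \<open>simp_all add:
          forall_6 vec_eq_iff\<close>)
    also have "\<dots> = det (vec6 (vec6 \<gamma> 0 0 0 0 0) (vec6 0 \<beta> 0 0 0 0) (vec6 0 0 c 0 0 0)
        (vec6 0 0 0 d 0 0) (vec6 0 0 0 0 e 0) ?r6)"
      by (rule det_add_row_multiple[of 5 2 _ _ "- 1 / \<beta>"]) (use \<beta> in \<open>simp_all add:
          forall_6 vec_eq_iff\<close>)
    also have "\<dots> = det (vec6 (vec6 \<gamma> 0 0 0 0 0) (vec6 0 \<beta> 0 0 0 0) (vec6 0 0 c 0 0 0)
        (vec6 0 0 0 d 0 0) (vec6 0 0 0 0 e 0) (vec6 0 0 0 0 0 f))"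
      (is "_ = det ?D")
      by (rule det_add_row_multiple[of 6 2 _ _ "- 1 / \<beta>"]) (use \<beta> in \<open>simp_all add:
          forall_6 vec_eq_iff\<close>)
    also have "\<dots> = (\<Prod>i\<in>UNIV. ?D $ i $ i)"
    proof (rule det_diagonal)
      have "\<forall>i j. i \<noteq> j \<longrightarrow> ?D $ i $ j = 0" by (simp add: forall_6)
      then show "?D $ i $ j = 0" if "i \<noteq> j" for i j using that by blast
    qed
    finally show ?thesis by (simp add: prod_6)
  qed
  also have "\<gamma> * \<beta> = \<alpha> * \<beta> - 1" using \<beta> by (simp add: \<gamma>_def
      left_diff_distrib)
  finally show ?thesis by (simp add: \<alpha>_def \<beta>_def)
qed

lemma linking_matrix_eq:
  "linking_matrix w = H_matrix (of_int (w $ 1)) (of_int (w $ 2)) (of_int (w $ 3)) (of_int (w $ 4)) (of_int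
      (w $ 5)) (of_int (w $ 6))"
  by (simp add: linking_matrix_def H_matrix_def vec_eq_iff forall_6 H_edges_def doubleton_eq_iff)

locale H_graph =
  fixes w :: "int ^ 6"
  assumes neg: "w $ v < 0" and negdef: "negative_definite (linking_matrix w)" and det1: "det
      (linking_matrix w) = 1"
begin

definition \<alpha> :: real where "\<alpha> = of_int (w $ 1) - 1 / of_int (w $ 3) - 1 / of_int (w $ 4)"
definition \<beta> :: real where "\<beta> = of_int (w $ 2) - 1 / of_int (w $ 5) - 1 / of_int (w $ 6)"
definition M :: int where "M = w $ 3 * w $ 4"
definition N :: int where "N = w $ 5 * w $ 6"
definition a :: int where "a = w $ 1 * M - w $ 4 - w $ 3"
definition b :: int where "b = w $ 2 * N - w $ 6 - w $ 5"

lemma nonzero: "w $ v \<noteq> 0" using neg[of v] by simp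

lemma MN_pos: "M > 0" "N > 0"
  using neg by (simp_all add: M_def N_def mult_neg_neg)

lemma a_eq: "of_int a = \<alpha> * of_int M" and b_eq: "of_int b = \<beta> * of_int N"
  using nonzero by (simp_all add: a_def b_def \<alpha>_def \<beta>_def M_def N_def field_simps)

lemma \<beta>_neg: "\<beta> < 0"
proof -
  let ?x = "vec6 0 1 0 0 (- 1 / of_int (w $ 5)) (- 1 / of_int (w $ 6)) :: real ^ 6"
  have "?x \<noteq> 0" by (auto simp: vec_eq_iff forall_6)
  then have "?x \<bullet> (linking_matrix w *v ?x) < 0" using negdef by (simp add: negative_definite_def)
  also have "?x \<bullet> (linking_matrix w *v ?x) = \<beta>"
    using nonzero by (simp add: inner_vec_def matrix_vector_mult_def linking_matrix_eq H_matrix_def sum_6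
        \<beta>_def field_simps)
  finally show ?thesis .
qed

lemma det_eq: "(\<alpha> * \<beta> - 1) * of_int (M * N) = 1"
  using det1 det_H_matrix[of "of_int (w $ 3)" "of_int (w $ 4)" "of_int (w $ 5)" "of_int (w $ 6)" "of_int (w
      $ 2)" "of_int (w $ 1)"]
    nonzero \<beta>_neg by (simp add: linking_matrix_eq \<alpha>_def \<beta>_def M_def N_def mult.assoc)

lemma unimodular: "a * b - M * N = 1"
proof -
  have "real_of_int (a * b - M * N) = 1"
    using det_eq by (simp add: a_eq b_eq algebra_simps)
  then show ?thesis by linarith
qed

lemma coprime_leaves: "coprime (w $ 3) (w $ 4)" "coprime (w $ 5) (w $ 6)"
proof -
  have "is_unit g" if "g dvd w $ 3" "g dvd w $ 4" for g
  proof -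
    have "g dvd a" "g dvd M" using that by (simp_all add: a_def M_def)
    then have "g dvd a * b - M * N" by simp
    then show ?thesis by (simp add: unimodular)
  qed
  then show "coprime (w $ 3) (w $ 4)" by (rule coprimeI)
  have "is_unit g" if "g dvd w $ 5" "g dvd w $ 6" for g
  proof -
    have "g dvd b" "g dvd N" using that by (simp_all add: b_def N_def)
    then have "g dvd a * b - M * N" by simp
    then show ?thesis by (simp add: unimodular)
  qed
  then show "coprime (w $ 5) (w $ 6)" by (rule coprimeI)
qed

text \<open>The negative of the Schur complement of the leaf block in the linking matrix.\<close>

definition schur :: "real ^ 2 ^ 2" where
  "schur = vector [vector [- \<alpha>, -1], vector [-1, - \<beta>]]"

lemma schur_S: "schur ** S_block w = mat 1"
proof -
  let ?W = "linking_matrix w"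
  define V where "V = matrix_inv ?W"
  have "invertible ?W" using det1 by (simp add: invertible_det_nz)
  then obtain B where B: "?W ** B = mat 1" unfolding invertible_def by blast
  then have "?W ** V = mat 1" using matrix_inv_eqI[OF B] by (simp add: V_def)
  then have entry: "(\<Sum>l\<in>UNIV. ?W $ i $ l * V $ l $ j) = (if i = j then 1 else 0)" for i j
    by (simp add: matrix_matrix_mult_def mat_def vec_eq_iff)
  have row: "\<alpha> * V $ 1 $ j + V $ 2 $ j = (if j = 1 then 1 else 0)"
    "V $ 1 $ j + \<beta> * V $ 2 $ j = (if j = 2 then 1 else 0)" if j: "j = 1 \<or> j = 2" for j
  proof -
    have leaf: "V $ 3 $ j = - V $ 1 $ j / of_int (w $ 3)" "V $ 4 $ j = - V $ 1 $ j / of_int (w $ 4)"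
      "V $ 5 $ j = - V $ 2 $ j / of_int (w $ 5)" "V $ 6 $ j = - V $ 2 $ j / of_int (w $ 6)"
      using entry[of 3 j] entry[of 4 j] entry[of 5 j] entry[of 6 j] nonzero j
      by (auto simp: linking_matrix_eq H_matrix_def sum_6 field_simps)
    show "\<alpha> * V $ 1 $ j + V $ 2 $ j = (if j = 1 then 1 else 0)"
      using entry[of 1 j] by (auto simp: linking_matrix_eq H_matrix_def sum_6 leaf \<alpha>_def algebra_simps)
    show "V $ 1 $ j + \<beta> * V $ 2 $ j = (if j = 2 then 1 else 0)"
      using entry[of 2 j] by (auto simp: linking_matrix_eq H_matrix_def sum_6 leaf \<beta>_def algebra_simps)
  qed
  show ?thesis
    using row[of 1] row[of 2]
    by (simp add: vec_eq_iff forall_2 matrix_matrix_mult_def sum_2 mat_def schur_def S_block_def Let_def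
        flip: V_def)
qed

lemma inv_S: "matrix_inv (S_block w) = schur"
  by (rule matrix_inv_eqI) (rule matrix_left_right_inverse[THEN iffD1, OF schur_S])

lemma S_eq: "S_block w = vector [vector [- of_int (M * b), of_int (M * N)], vector [of_int (M * N), -
    of_int (N * a)]]"
proof -
  let ?T = "vector [vector [- of_int (M * b), of_int (M * N)], vector [of_int (M * N), - of_int (N * a)]]
      :: real ^ 2 ^ 2"
  have "?T ** schur = mat 1"
    using det_eq by (simp add: vec_eq_iff forall_2 matrix_matrix_mult_def sum_2 mat_def schur_def a_eq b_eq
        algebra_simps)
  then have "schur ** ?T = mat 1" by (rule matrix_left_right_inverse[THEN iffD1])
  then show ?thesis using matrix_inv_eqI[OF schur_S] matrix_inv_eqI[of schur ?T] by simp
qed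

lemma quadratic_form: "vector [x, y] \<bullet> (matrix_inv (S_block w) *v vector [x, y]) = - (\<alpha> *
    x\<^sup>2 + 2 * x * y + \<beta> * y\<^sup>2)"
  by (simp add: inv_S schur_def inner_vec_def matrix_vector_mult_def sum_2 power2_eq_square algebra_simps)

lemma S_lattice:
  "{c *\<^sub>R (S_block w *v x) | x. \<forall>i. x $ i \<in> \<int>} = {vector [c * of_int (M * i), c *
      of_int (N * j)] | i j. True}"
  (is "?L = ?R")
proof
  have S: "S_block w *v vector [of_int p, of_int q] = vector [of_int (M * (N * q - b * p)), of_int (N * (M
      * p - a * q))]" for p q
    by (simp add: S_eq vec_eq_iff forall_2 matrix_vector_mult_def sum_2 algebra_simps)
  show "?L \<subseteq> ?R"
  proof
    fix z assume "z \<in> ?L"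
    then obtain x where x: "z = c *\<^sub>R (S_block w *v x)" "\<forall>i. x $ i \<in> \<int>" by blast
    obtain p q where "x $ 1 = of_int p" "x $ 2 = of_int q" using x(2) by (meson Ints_cases)
    then have "x = vector [of_int p, of_int q]" by (simp add: vec_eq_iff forall_2)
    then have "z = vector [c * of_int (M * (N * q - b * p)), c * of_int (N * (M * p - a * q))]"
      unfolding x(1) by (simp only: S) (simp add: vec_eq_iff forall_2)
    then show "z \<in> ?R" by blast
  qed
  show "?R \<subseteq> ?L"
  proof
    fix z assume "z \<in> ?R"
    then obtain i j where z: "z = vector [c * of_int (M * i), c * of_int (N * j)]" by blast
    define p where "p = - (a * i + N * j)"
    define q where "q = - (M * i + b * j)"
    have "N * q - b * p = (a * b - M * N) * i" "M * p - a * q = (a * b - M * N) * j"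
      by (simp_all add: p_def q_def algebra_simps)
    then have "N * q - b * p = i" "M * p - a * q = j" by (simp_all add: unimodular)
    then have "z = c *\<^sub>R (S_block w *v vector [of_int p, of_int q])"
      unfolding z S by (simp add: vec_eq_iff forall_2)
    moreover have "\<forall>i. (vector [of_int p, of_int q] :: real ^ 2) $ i \<in> \<int>" by (simp add: forall_2)
    ultimately show "z \<in> ?L" by blast
  qed
qed

end

section \<open>The power series of \<open>G\<close>\<close>

lemma add_less_mult:
  fixes p q :: int
  assumes "p > 1" "q > 1" "p \<noteq> q"
  shows "p + q < p * q"
proof (cases "p < q")
  case True
  have "2 * q \<le> p * q" using assms by (intro mult_right_mono) auto
  then show ?thesis using True by linarith
next
  case False
  have "p * 2 \<le> p * q" using assms by (intro mult_left_mono) auto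
  then show ?thesis using False assms(3) by linarith
qed

lemma chi_eq_pos:
  assumes p: "p > 1" and q: "q > 1" and ne: "p \<noteq> q"
  shows "chi p q n = (if n mod (2 * p * q) \<in> {p * q + p + q, p * q - p - q} then 1
    else if n mod (2 * p * q) \<in> {p * q + p - q, p * q - p + q} then - 1 else 0)"
proof -
  have big: "p + q < p * q" by (rule add_less_mult[OF p q ne])
  define T where "T = 2 * p * q"
  define r where "r = n mod T"
  have T: "T = 2 * (p * q)" by (simp add: T_def)
  have res: "(q * 1 + p * 1 + p * q) mod T = p * q + p + q" "(q * 1 + p * - 1 + p * q) mod T = p * q - p + q"
    "(q * - 1 + p * 1 + p * q) mod T = p * q + p - q" "(q * - 1 + p * - 1 + p * q) mod T = p * q - p - q"
    using big p q unfolding T by (subst mod_pos_pos_trivial; linarith)+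
  define P where "P s \<longleftrightarrow> (\<exists>e\<in>{1, -1}. \<exists>e'\<in>{1, -1}. s = e * e'
      \<and> n mod T = (q * e + p * e' + p * q) mod T)" for s
  have P: "P s \<longleftrightarrow> s = 1 \<and> r \<in> {p * q + p + q, p * q - p - q} \<or> s = - 1
      \<and> r \<in> {p * q + p - q, p * q - p + q}" for s
    unfolding P_def r_def[symmetric] by (simp only: res bex_simps(5) insert_iff empty_iff bex_simps(7)) auto
  have disj: "{p * q + p + q, p * q - p - q} \<inter> {p * q + p - q, p * q - p + q} = {}"
    using p q by auto
  have some: "(SOME s. P s) = t" if "P t" for t
  proof (rule some_equality)
    show "P t" by (rule that)
    show "s = t" if "P s" for s using that \<open>P t\<close> disj unfolding P by blast
  qed
  have "chi p q n = (if \<exists>s. P s then SOME s. P s else 0)" by (simp only: chi_def Let_def P_def T_def)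
  also have "\<dots> = (if r \<in> {p * q + p + q, p * q - p - q} then 1
    else if r \<in> {p * q + p - q, p * q - p + q} then - 1 else 0)"
  proof -
    consider "r \<in> {p * q + p + q, p * q - p - q}" | "r \<notin> {p * q + p + q, p * q - p - q}" "r
        \<in> {p * q + p - q, p * q - p + q}"
      | "r \<notin> {p * q + p + q, p * q - p - q}" "r \<notin> {p * q + p - q, p * q - p + q}" by blast
    then show ?thesis
    proof cases
      case 1
      then have "P 1" unfolding P by blast
      then show ?thesis using some[of 1] 1 by (simp only: exI[of P 1] if_True)
    next
      case 2
      then have "P (- 1)" unfolding P by blast
      then show ?thesis using some[of "- 1"] 2 by (simp only: exI[of P "- 1"] if_True if_False)
    next
      case 3
      then have "\<not> (\<exists>s. P s)" unfolding P by blast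
      then show ?thesis using 3 by (simp only: if_False)
    qed
  qed
  finally show ?thesis by (simp only: r_def T_def)
qed

lemma chi_minus: "chi (- p) (- q) n = chi p q n"
proof -
  have "(\<exists>e\<in>{1, -1}. \<exists>e'\<in>{1, -1}. s = e * e' \<and> n mod (2 * - p * - q) = (- q *
      e + - p * e' + - p * - q) mod (2 * - p * - q)) \<longleftrightarrow>
    (\<exists>e\<in>{1, -1}. \<exists>e'\<in>{1, -1}. s = e * e' \<and> n mod (2 * p * q) = (q * e + p * e'
        + p * q) mod (2 * p * q))" for s
    by (auto simp: algebra_simps)
  then show ?thesis unfolding chi_def Let_def by presburger
qed

lemma G_minus: "G (- p) (- q) z = G p q z"
  by (simp add: G_def algebra_simps)

lemma residue_class_series:
  fixes z :: complex
  assumes z: "norm z < 1" and c: "c < T"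
  shows "(\<lambda>n. if n mod T = c then z ^ n else 0) sums (z ^ c / (1 - z ^ T))"
proof -
  let ?g = "\<lambda>j. c + T * j"
  have T: "T > 0" using c by simp
  have "norm (z ^ T) < 1" using z T by (simp add: norm_power power_less_one_iff)
  then have "(\<lambda>j. z ^ c * (z ^ T) ^ j) sums (z ^ c * (1 / (1 - z ^ T)))"
    by (intro sums_mult geometric_sums)
  then have "(\<lambda>j. (\<lambda>n. if n mod T = c then z ^ n else 0) (?g j)) sums (z ^ c / (1 - z ^ T))"
    using c by (simp add: power_add power_mult)
  moreover have "strict_mono ?g" using T by (simp add: strict_mono_def)
  moreover have "(if n mod T = c then z ^ n else 0) = 0" if "n \<notin> range ?g" for n
  proof -
    have "n mod T \<noteq> c"
    proof
      assume "n mod T = c"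
      then have "n = ?g (n div T)" by (metis add.commute mult_div_mod_eq)
      then show False using that by blast
    qed
    then show ?thesis by simp
  qed
  ultimately show ?thesis using sums_mono_reindex[of ?g "\<lambda>n. if n mod T = c then z ^ n else 0"] by blast
qed

lemma G_series_nat:
  fixes z :: complex and p q :: nat
  assumes p: "p > 1" and q: "q > 1" and ne: "p \<noteq> q" and z: "norm z < 1"
  shows "(\<lambda>n. - (of_int (chi (int p) (int q) (int (Suc n))) * z ^ Suc n)) sums G (int p) (int q) z"
proof -
  have big: "p + q < p * q"
    using add_less_mult[of "int p" "int q"] p q ne by (simp flip: of_nat_add of_nat_mult)
  define T where "T = 2 * p * q"
  define c1 c2 c3 c4 where "c1 = p * q + p + q" and "c2 = p * q - p - q" and "c3 = p * q + p - q" and "c4 =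
      p * q - p + q"
  have cT: "c1 < T" "c2 < T" "c3 < T" "c4 < T" and c0: "c1 > 0" "c2 > 0" "c3 > 0" "c4 > 0"
    using big p q by (auto simp: c1_def c2_def c3_def c4_def T_def)
  have dist: "c1 \<noteq> c2" "c1 \<noteq> c3" "c1 \<noteq> c4" "c2 \<noteq> c3" "c2 \<noteq> c4" "c3 \<noteq> c4"
    using big p q ne by (auto simp: c1_def c2_def c3_def c4_def)
  let ?s = "\<lambda>c n. if n mod T = c then z ^ n else 0"
  define f where "f n = of_int (chi (int p) (int q) (int n)) * z ^ n" for n
  have f: "f n = ?s c1 n + ?s c2 n - ?s c3 n - ?s c4 n" for n
  proof -
    have less: "p \<le> p * q" "q \<le> p * q" using big by linarith+
    have "int n mod (2 * int p * int q) = int (n mod T)" by (simp add: T_def zmod_int)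
    moreover have "int p * int q + int p + int q = int c1" "int p * int q - int p - int q = int c2"
      "int p * int q + int p - int q = int c3" "int p * int q - int p + int q = int c4"
      using big less by (simp_all add: c1_def c2_def c3_def c4_def of_nat_diff)
    ultimately have "chi (int p) (int q) (int n) = (if n mod T \<in> {c1, c2} then 1 else if n mod T \<in>
        {c3, c4} then -1 else 0)"
      using p q ne by (simp add: chi_eq_pos)
    then show ?thesis using dist by (simp add: f_def)
  qed
  have "f sums (z ^ c1 / (1 - z ^ T) + z ^ c2 / (1 - z ^ T) - z ^ c3 / (1 - z ^ T) - z ^ c4 / (1 - z ^ T))"
    unfolding f using cT by (intro sums_add sums_diff residue_class_series z)
  moreover have "f 0 = 0" using c0 by (simp add: f)
  ultimately have "(\<lambda>n. - f (Suc n)) sums - (z ^ c1 / (1 - z ^ T) + z ^ c2 / (1 - z ^ T) - z ^ c3 /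
      (1 - z ^ T) - z ^ c4 / (1 - z ^ T))"
    by (intro sums_minus) (simp add: sums_Suc_iff)
  moreover have "G (int p) (int q) z = - (z ^ c1 / (1 - z ^ T) + z ^ c2 / (1 - z ^ T) - z ^ c3 / (1 - z ^
      T) - z ^ c4 / (1 - z ^ T))"
  proof (cases "z = 0")
    case True
    then show ?thesis using c0 p by (simp add: G_def power_0_left)
  next
    case False
    define x y t where "x = z ^ p" and "y = z ^ q" and "t = z ^ (p * q)"
    have nz: "x \<noteq> 0" "y \<noteq> 0" "t \<noteq> 0" using False by (simp_all add: x_def y_def t_def)
    have tt: "z ^ T = t * t" by (simp add: T_def t_def mult_2 power_add distrib_right)
    have "c2 + (p + q) = p * q" "c3 + q = p * q + p" "c4 + p = p * q + q"
      using big unfolding c2_def c3_def c4_def by linarith+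
    then have "z ^ c2 * (x * y) = t" "z ^ c3 * y = t * x" "z ^ c4 * x = t * y"
      unfolding x_def y_def t_def power_add[symmetric] by simp_all
    then have pows: "z ^ c2 = t / (x * y)" "z ^ c3 = t * x / y" "z ^ c4 = t * y / x"
      using nz by (simp_all add: eq_divide_eq)
    have c1: "z ^ c1 = t * x * y" by (simp add: c1_def x_def y_def t_def power_add)
    have "(x - inverse x) * (y - inverse y) = (x * x - 1) * (y * y - 1) / (x * y)"
      "t - inverse t = - (1 - t * t) / t"
      using nz by (simp_all add: field_simps)
    then have "G (int p) (int q) z = ((x * x - 1) * (y * y - 1) / (x * y)) / (- (1 - t * t) / t)"
      by (simp add: G_def x_def y_def t_def power_int_minus flip: of_nat_mult)
    also have "\<dots> = - ((t * x * y + t / (x * y) - t * x / y - t * y / x) / (1 - t * t))"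
    proof -
      have "(x * x - 1) * (y * y - 1) / (x * y) * t = t * x * y + t / (x * y) - t * x / y - t * y / x"
        using nz by (simp add: field_simps)
      then show ?thesis by (simp only: divide_divide_eq_right divide_minus_right)
    qed
    finally show ?thesis unfolding pows c1 tt by (simp only: add_divide_distrib diff_divide_distrib)
  qed
  ultimately show ?thesis by (simp add: f_def)
qed

lemma G_series:
  fixes z :: complex and p q :: int
  assumes pq: "p * q > 0" "p \<noteq> q" "\<bar>p\<bar> > 1" "\<bar>q\<bar> > 1" and z: "norm z < 1"
  shows "(\<lambda>n. - (of_int (chi p q (int (Suc n))) * z ^ Suc n)) sums G p q z"
proof -
  have "(\<lambda>n. - (of_int (chi \<bar>p\<bar> \<bar>q\<bar> (int (Suc n))) * z ^ Suc n)) sums G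
      \<bar>p\<bar> \<bar>q\<bar> z"
    using G_series_nat[of "nat \<bar>p\<bar>" "nat \<bar>q\<bar>", OF _ _ _ z] pq by (auto simp:
        zero_less_mult_iff)
  moreover have "p > 0 \<and> q > 0 \<or> p < 0 \<and> q < 0" using pq(1) by (simp add: zero_less_mult_iff)
  ultimately show ?thesis using chi_minus[of p q] G_minus[of p q] by auto
qed

section \<open>The reduced sum\<close>

lemma A_coeff_zdiff:
  "A_coeff k v v' m = zdiff k (of_int m / (2 * of_int v)) * zdiff k (of_int m / (2 * of_int v')) / zdiff k
      (of_int m / 2)"
  by (simp add: A_coeff_def zdiff_def)

lemma A_coeff_periodic:
  assumes k: "k > 0" and "v \<noteq> 0" "v' \<noteq> 0"
  shows "A_coeff k v v' (m + 2 * int k * (v * v') * y) = A_coeff k v v' m"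
proof -
  have "zdiff k (of_int (m + 2 * int k * (v * v') * y) / (2 * of_int v)) = zdiff k (of_int m / (2 * of_int v))"
    by (rule zdiff_cong[OF k, of _ _ "v' * y"]) (use assms in \<open>simp add: field_simps\<close>)
  moreover have "zdiff k (of_int (m + 2 * int k * (v * v') * y) / (2 * of_int v')) = zdiff k (of_int m / (2
      * of_int v'))"
    by (rule zdiff_cong[OF k, of _ _ "v * y"]) (use assms in \<open>simp add: field_simps\<close>)
  moreover have "zdiff k (of_int (m + 2 * int k * (v * v') * y) / 2) = zdiff k (of_int m / 2)"
    by (rule zdiff_cong[OF k, of _ _ "v * v' * y"]) (simp add: field_simps)
  ultimately show ?thesis by (simp add: A_coeff_zdiff)
qed

lemma A_coeff_eq_0: "k > 0 \<Longrightarrow> int k dvd m \<Longrightarrow> A_coeff k v v' m = 0"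
  by (simp add: A_coeff_zdiff zdiff_eq_0)

lemma G_zeta:
  assumes "v \<noteq> 0" "v' \<noteq> 0"
  shows "G v v' (zeta k (of_int m / (2 * of_int (v * v')))) = A_coeff k v v' m"
  using assms by (simp add: G_def zeta_power_int A_coeff_def mult.commute)

context H_graph
begin

definition Q :: "nat \<Rightarrow> int \<Rightarrow> int \<Rightarrow> complex" where
  "Q k m n = zeta k ((\<alpha> * of_int m ^ 2 + 2 * of_int m * of_int n + \<beta> * of_int n ^ 2) / 4)"

lemma Q_periodic:
  assumes k: "k > 0"
  shows "Q k (m + 2 * int k * M * i) (n + 2 * int k * N * j) = Q k m n"
proof -
  have \<alpha>: "\<alpha> = of_int a / of_int M" and \<beta>: "\<beta> = of_int b / of_int N"
    using MN_pos by (simp_all add: a_eq b_eq)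
  show ?thesis unfolding Q_def
    by (rule zeta_cong[OF k, of _ _ "a * (m * i + int k * M * i\<^sup>2) + b * (n * j + int k * N * j\<^sup>2)
        + m * N * j + n * M * i + 2 * int k * M * N * i * j"])
      (use MN_pos in \<open>simp add: \<alpha> \<beta> field_simps power2_eq_square\<close>)
qed

definition summand :: "nat \<Rightarrow> int \<Rightarrow> int \<Rightarrow> complex" where
  "summand k m n = Q k m n * A_coeff k (w $ 3) (w $ 4) m * A_coeff k (w $ 5) (w $ 6) n"

lemma summand_periodic:
  assumes k: "k > 0"
  shows "summand k (m + 2 * int k * M * i) (n + 2 * int k * N * j) = summand k m n"
  unfolding summand_def Q_periodic[OF k] unfolding M_def N_def
  by (simp only: A_coeff_periodic[OF k] nonzero not_False_eq_True)

lemma summand_eq_0: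
  assumes "k > 0" "int k dvd m \<or> int k dvd n"
  shows "summand k m n = 0"
  using A_coeff_eq_0[OF assms(1)] assms(2) by (auto simp: summand_def)

lemma node_leaf_odd:
  "node_factor k u (- x) * leaf_term k v (- x) * leaf_term k v' (- x) = - (node_factor k u x * leaf_term k
      v x * leaf_term k v' x)"
proof -
  have "node_factor k u (- x) = - node_factor k u x" "leaf_term k v (- x) = - leaf_term k v x" for v
    using zdiff_minus[of k "of_int x / 2"] zdiff_minus[of k "of_int x / (2 * of_int v)"]
    by (simp_all add: node_factor_def leaf_term_def)
  then show ?thesis by simp
qed

lemma node_factor_periodic:
  "k > 0 \<Longrightarrow> node_factor k u (x + 2 * int k * y) = node_factor k u x"
  by (simp only: node_factor_def weight_periodic zdiff_half_periodic[OF _ refl])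

lemma reduced_sum:
  assumes k: "k > 0"
  shows "(\<Sum>m\<in>{0..<2 * int k}. \<Sum>n\<in>{0..<2 * int k}.
      node_factor k (w $ 1) m * node_factor k (w $ 2) n * (zdiff k (of_int (m * n) / 2) / 2) *
      (\<Sum>l\<in>{0..<2 * int k}. leaf_summand k (w $ 3) m l) * (\<Sum>l\<in>{0..<2 * int k}.
          leaf_summand k (w $ 4) m l) *
      ((\<Sum>l\<in>{0..<2 * int k}. leaf_summand k (w $ 5) n l) * (\<Sum>l\<in>{0..<2 * int k}.
          leaf_summand k (w $ 6) n l)))
    = leaf_const k (w $ 3) * leaf_const k (w $ 4) * (leaf_const k (w $ 5) * leaf_const k (w $ 6)) *
      zeta k (- (of_int (w $ 1) + of_int (w $ 2)) / 4) *
      (\<Sum>x\<in>{0..<2 * int k * M}. \<Sum>y\<in>{0..<2 * int k * N}. summand k x y)"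
  (is "?lhs = ?C34 * ?C56 * ?z * ?rhs")
proof -
  let ?I = "{0..<2 * int k}" and ?IM = "{0..<2 * int k * M}" and ?IN = "{0..<2 * int k * N}"
  define L where "L v m = leaf_const k (w $ v) * (\<Sum>n\<in>{0..<- w $ v}. leaf_term k (w $ v) (m + 2 *
      int k * n))" for v m
  have L: "(\<Sum>l\<in>?I. leaf_summand k (w $ v) m l) = L v m" for v m
    unfolding leaf_summand_def leaf_sum[OF k neg] L_def ..
  define n1 n2 e where "n1 = node_factor k (w $ 1)" and "n2 = node_factor k (w $ 2)"
    and "e m n = zdiff k (of_int (m * n) / 2) / 2" for m n
  define t where "t v = leaf_term k (w $ v)" for v
  have nper: "n1 (x + 2 * int k * y) = n1 x" "n2 (x + 2 * int k * y) = n2 x" for x y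
    unfolding n1_def n2_def by (simp_all only: node_factor_periodic[OF k])
  have eper: "e (m + 2 * int k * y) n = e m n" "e m (n + 2 * int k * y) = e m n" for m n y
  proof -
    have "zdiff k (of_int ((m + 2 * int k * y) * n) / 2) = zdiff k (of_int (m * n) / 2)"
      by (rule zdiff_half_periodic[OF k, of _ _ "y * n"]) (simp add: algebra_simps)
    then show "e (m + 2 * int k * y) n = e m n" by (simp only: e_def)
    have "zdiff k (of_int (m * (n + 2 * int k * y)) / 2) = zdiff k (of_int (m * n) / 2)"
      by (rule zdiff_half_periodic[OF k, of _ _ "m * y"]) (simp add: algebra_simps)
    then show "e m (n + 2 * int k * y) = e m n" by (simp only: e_def)
  qed
  have inner: "(\<Sum>n\<in>?I. n2 n * e x n * L 5 n * L 6 n) = ?C56 * (\<Sum>y\<in>?IN. n2 y * e x y * t 5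
      y * t 6 y)" for x
    unfolding L_def N_def t_def
    by (rule leaf_pair_sum[OF k neg neg coprime_leaves(2)]) (simp only: nper eper)
  have "?lhs = (\<Sum>m\<in>?I. n1 m * (\<Sum>n\<in>?I. n2 n * e m n * L 5 n * L 6 n) * L 3 m * L 4 m)"
    unfolding L n1_def[symmetric] n2_def[symmetric] e_def[symmetric]
    by (simp add: sum_distrib_left sum_distrib_right mult_ac)
  also have "\<dots> = ?C34 * (\<Sum>x\<in>?IM. n1 x * (\<Sum>n\<in>?I. n2 n * e x n * L 5 n * L 6 n) * t 3
      x * t 4 x)"
    unfolding L_def M_def t_def
    by (rule leaf_pair_sum[OF k neg neg coprime_leaves(1)]) (simp only: nper eper)
  finally have lhs: "?lhs = ?C34 * (\<Sum>x\<in>?IM. n1 x * (?C56 * (\<Sum>y\<in>?IN. n2 y * e x y * t 5 y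
      * t 6 y)) * t 3 x * t 4 x)"
    unfolding inner .
  define B where "B x = n1 x * t 3 x * t 4 x" for x
  define B' where "B' y = n2 y * t 5 y * t 6 y" for y
  \<comment> \<open>\<open>B\<close> is odd, so both exponentials in \<open>e\<close> contribute the same.\<close>
  have symm: "(\<Sum>x\<in>?IM. B' y * (B x * e x y)) = (\<Sum>x\<in>?IM. B' y * (B x * zeta k (of_int (x *
      y) / 2)))" for y
  proof -
    define f where "f x = B x * zeta k (of_int (x * y) / 2)" for x
    have Bper: "B (x + 2 * int k * M * z) = B x" for x z
      using nper(1)[of x "M * z"] leaf_term_periodic[OF k nonzero[of 3], of x "w $ 4 * z"]
        leaf_term_periodic[OF k nonzero[of 4], of x "w $ 3 * z"]
      by (simp add: B_def t_def M_def mult_ac)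
    have "f (x + 2 * int k * M * z) = f x" for x z
    proof -
      have "zeta k (of_int ((x + 2 * int k * M * z) * y) / 2) = zeta k (of_int (x * y) / 2)"
        by (rule zeta_cong[OF k, of _ _ "M * z * y"]) (simp add: field_simps)
      then show ?thesis by (simp only: f_def Bper)
    qed
    then have refl: "(\<Sum>x\<in>?IM. f (- x)) = (\<Sum>x\<in>?IM. f x)"
      using k MN_pos by (intro sum_residues_reflect) auto
    have "f (- x) = - (B x * zeta k (- (of_int (x * y) / 2)))" for x
      using node_leaf_odd by (simp add: f_def B_def n1_def t_def)
    then have "B x * e x y = (f x + f (- x)) / 2" for x
      by (simp add: f_def e_def zdiff_def field_simps)
    then have "(\<Sum>x\<in>?IM. B x * e x y) = ((\<Sum>x\<in>?IM. f x) + (\<Sum>x\<in>?IM. f (- x))) / 2"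
      by (simp only: sum.distrib sum_divide_distrib[symmetric])
    also have "\<dots> = (\<Sum>x\<in>?IM. f x)" by (simp add: refl)
    finally show ?thesis by (simp only: sum_distrib_left[symmetric] f_def)
  qed
  have "?lhs = ?C34 * ?C56 * (\<Sum>y\<in>?IN. \<Sum>x\<in>?IM. B' y * (B x * e x y))"
    unfolding lhs B_def B'_def
    by (subst sum.swap) (simp add: sum_distrib_left sum_distrib_right mult_ac)
  also have "(\<Sum>y\<in>?IN. \<Sum>x\<in>?IM. B' y * (B x * e x y)) = ?z * ?rhs"
  proof -
    have "B' y * (B x * zeta k (of_int (x * y) / 2)) = ?z * summand k x y" for x y
    proof -
      have eq: "?z * Q k x y = zeta k (of_int (w $ 1) * (of_int x ^ 2 - 1) / 4) * zeta k (- (of_int x ^ 2)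
          / (4 * of_int (w $ 3)))
          * zeta k (- (of_int x ^ 2) / (4 * of_int (w $ 4))) * zeta k (of_int (w $ 2) * (of_int y ^ 2 - 1) / 4)
          * zeta k (- (of_int y ^ 2) / (4 * of_int (w $ 5))) * zeta k (- (of_int y ^ 2) / (4 * of_int (w $ 6)))
          * zeta k (of_int (x * y) / 2)"
        unfolding Q_def zeta_add[symmetric] \<alpha>_def \<beta>_def
        using nonzero by (intro arg_cong[where f="zeta k"]) (simp add: field_simps)
      have "?z * summand k x y = ?z * Q k x y * A_coeff k (w $ 3) (w $ 4) x * A_coeff k (w $ 5) (w $ 6) y"
        by (simp only: summand_def mult.assoc)
      also have "\<dots> = B' y * (B x * zeta k (of_int (x * y) / 2))"
        unfolding eq B_def B'_def n1_def n2_def t_def node_factor_def leaf_term_def A_coeff_zdiff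
        by (simp only: divide_inverse mult_ac)
      finally show ?thesis by (rule sym)
    qed
    then show ?thesis unfolding symm by (subst sum.swap) (simp only: sum_distrib_left[symmetric])
  qed
  finally show ?thesis by (simp only: mult.assoc)
qed

lemma leaf_const_prod:
  assumes k: "k > 0"
  shows "leaf_const k (w $ 3) * leaf_const k (w $ 4) * (leaf_const k (w $ 5) * leaf_const k (w $ 6)) =
    - (4 * of_nat k ^ 2 / of_real (sqrt (of_int (M * N)))) *
      zeta k (- ((\<Sum>v\<in>{3,4,5,6}. of_int (w $ v)) + (\<Sum>v\<in>{3,4,5,6}. 1 / of_int (w $ v))) / 4)"
proof -
  let ?s = "\<lambda>v. sqrt (real k / - of_int (w $ v))" and ?z = "\<lambda>v. zeta k (- (of_int (w $ v) +
      1 / of_int (w $ v)) / 4)"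
  have "?s 3 * ?s 4 * (?s 5 * ?s 6) = sqrt ((real k ^ 2)\<^sup>2 / of_int (M * N))"
    using nonzero by (simp add: M_def N_def real_sqrt_mult[symmetric] power2_eq_square mult_ac)
  also have "\<dots> = real k ^ 2 / sqrt (of_int (M * N))"
    by (simp only: real_sqrt_divide real_sqrt_abs) simp
  finally have s: "complex_of_real (?s 3) * of_real (?s 4) * (of_real (?s 5) * of_real (?s 6)) = of_nat k ^
      2 / of_real (sqrt (of_int (M * N)))"
    by (simp flip: of_real_mult)
  have z: "?z 3 * ?z 4 * (?z 5 * ?z 6) =
      zeta k (- ((\<Sum>v\<in>{3,4,5,6}. of_int (w $ v)) + (\<Sum>v\<in>{3,4,5,6}. 1 / of_int (w $ v))) / 4)"
    unfolding zeta_add[symmetric] by (intro arg_cong[where f="zeta k"]) (simp add: field_simps)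
  have i: "(1 - \<i>) * (1 - \<i>) * ((1 - \<i>) * (1 - \<i>)) = - 4"
    by (simp add: complex_eq_iff)
  have "leaf_const k (w $ 3) * leaf_const k (w $ 4) * (leaf_const k (w $ 5) * leaf_const k (w $ 6)) =
     (?z 3 * ?z 4 * (?z 5 * ?z 6)) * (complex_of_real (?s 3) * of_real (?s 4) * (of_real (?s 5) * of_real (?s 6)))
      * ((1 - \<i>) * (1 - \<i>) * ((1 - \<i>) * (1 - \<i>)))"
    by (simp only: leaf_const_def minus_mult_minus mult_minus_left mult_minus_right) (simp only: mult_ac
        minus_minus)
  then show ?thesis unfolding s z i by simp
qed

definition prefactor :: "nat \<Rightarrow> complex" where
  "prefactor k = \<i> * zeta k (- (18 + (\<Sum>v\<in>UNIV. of_int (w $ v)) + (\<Sum>v\<in>{3,4,5,6}. 1 /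
      of_int (w $ v))) / 4)
             / (4 * of_nat k * (zeta (2 * k) 1 - inverse (zeta (2 * k) 1)) * of_real (sqrt (of_int (M * N))))"

lemma tau_reduced:
  assumes k: "k > 0"
  shows "tau k w = prefactor k * (\<Sum>x\<in>{0..<2 * int k * M}. \<Sum>y\<in>{0..<2 * int k * N}. summand k x y)"
proof -
  define D where "D = zeta (2 * k) 1 - inverse (zeta (2 * k) 1)"
  let ?z = "zeta k (- ((\<Sum>v\<in>{3,4,5,6}. of_int (w $ v)) + (\<Sum>v\<in>{3,4,5,6}. 1 / of_int (w $ v))) / 4)"
  have z: "zeta k (- (18 + (\<Sum>v\<in>UNIV. of_int (w $ v)) + (\<Sum>v\<in>{3,4,5,6}. 1 / of_int (w $ v))) / 4) =
      zeta k (- 9 / 2) * ?z * zeta k (- (of_int (w $ 1) + of_int (w $ 2)) / 4)"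
    unfolding zeta_add[symmetric] by (intro arg_cong[where f="zeta k"]) (simp add: sum_6 field_simps)
  have cancel: "- \<i> * u / (16 * of_nat k ^ 3 * D) * (- (4 * of_nat k ^ 2 / r) * v * v') =
      \<i> * (u * v * v') / (4 * of_nat k * D * r)" for u v v' r :: complex
    using k by (simp add: power2_eq_square power3_eq_cube mult_ac)
  have pre: "- \<i> * zeta k (- 9 / 2) / (16 * of_nat k ^ 3 * D) *
      (- (4 * of_nat k ^ 2 / of_real (sqrt (of_int (M * N)))) * ?z * zeta k (- (of_int (w $ 1) + of_int (w
          $ 2)) / 4)) = prefactor k"
    unfolding prefactor_def z D_def[symmetric] by (rule cancel)
  show ?thesis
    unfolding tau_double_sum[OF k] reduced_sum[OF k] leaf_const_prod[OF k] pre[symmetric] D_def[symmetric]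
    by (simp only: mult.assoc)
qed

lemma coset_sum_pairs:
  assumes k: "k > 0" and per: "\<And>m n i j. f (m + 2 * int k * M * i) (n + 2 * int k * N * j) = f m n"
    and zero: "\<And>m n. int k dvd m \<or> int k dvd n \<Longrightarrow> f m n = 0"
    and F: "\<And>m n. F (vector [of_int m, of_int n]) = f m n"
  shows "coset_sum {vector [of_int m, of_int n] :: real ^ 2 | m n. \<not> int k dvd m \<and> \<not> int k dvd n}
      {(2 * real k) *\<^sub>R (S_block w *v x) | x. \<forall>i. x $ i \<in> \<int>} F =
    (\<Sum>x\<in>{0..<2 * int k * M}. \<Sum>y\<in>{0..<2 * int k * N}. f x y)"
proof -
  let ?L = "{vector [2 * real k * of_int (M * i), 2 * real k * of_int (N * j)] :: real ^ 2 | i j. True}"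
  let ?X = "{vector [of_int m, of_int n] :: real ^ 2 | m n. \<not> int k dvd m \<and> \<not> int k dvd n}"
  let ?P = "{x \<in> {0..<2 * int k * M}. \<not> int k dvd x} \<times> {x \<in> {0..<2 * int k * N}. \<not>
      int k dvd x}"
  let ?v = "\<lambda>p. vector [of_int (fst p), of_int (snd p)] :: real ^ 2"
  have v_eq: "(vector [a, b] :: real ^ 2) = vector [c, d] \<longleftrightarrow> a = c \<and> b = d" for a b c d
    by (simp add: vec_eq_iff forall_2)
  have v_diff: "(vector [a, b] :: real ^ 2) - vector [c, d] = vector [a - c, b - d]" for a b c d
    by (simp add: vec_eq_iff forall_2)
  have L: "vector [of_int m, of_int n] - vector [of_int m', of_int n'] \<in> ?L \<longleftrightarrow>
      (\<exists>i j. m = m' + 2 * int k * M * i \<and> n = n' + 2 * int k * N * j)" for m n m' n'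
  proof -
    have "real_of_int m - of_int m' = 2 * real k * of_int (A * i) \<longleftrightarrow> m = m' + 2 * int k
        * A * i" for m m' A i
    proof -
      have "2 * real k * of_int (A * i) = real_of_int (2 * int k * A * i)" by simp
      then show ?thesis by linarith
    qed
    then show ?thesis by (simp add: v_diff v_eq del: of_int_mult)
  qed
  have "coset_sum ?X ?L F = (\<Sum>r\<in>?v ` ?P. F r)"
  proof (rule coset_sum_transversal)
    show "0 \<in> ?L" by (auto simp: vec_eq_iff forall_2 intro!: exI[of _ 0])
    show "z - z' \<in> ?L" if "z \<in> ?L" "z' \<in> ?L" for z z'
    proof -
      obtain i j where z: "z = vector [2 * real k * of_int (M * i), 2 * real k * of_int (N * j)]"
        using \<open>z \<in> ?L\<close> by blast
      obtain i' j' where z': "z' = vector [2 * real k * of_int (M * i'), 2 * real k * of_int (N * j')]"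
        using \<open>z' \<in> ?L\<close> by blast
      have "z - z' = vector [2 * real k * of_int (M * (i - i')), 2 * real k * of_int (N * (j - j'))]"
        unfolding z z' v_diff by (simp add: right_diff_distrib)
      then show ?thesis by blast
    qed
    show "F x = F y" if "x \<in> ?X" "y \<in> ?X" "x - y \<in> ?L" for x y
    proof -
      obtain m n m' n' where xy: "x = vector [of_int m, of_int n]" "y = vector [of_int m', of_int n']"
        using \<open>x \<in> ?X\<close> \<open>y \<in> ?X\<close> by blast
      then obtain i j where "m = m' + 2 * int k * M * i" "n = n' + 2 * int k * N * j"
        using \<open>x - y \<in> ?L\<close> L by auto
      then show ?thesis unfolding xy F by (simp only: per)
    qed
    show "?v ` ?P \<subseteq> ?X" by fastforce
    fix x assume "x \<in> ?X"
    then obtain m n where x: "x = vector [of_int m, of_int n]" "\<not> int k dvd m" "\<not> int k dvd n" by blast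
    define r where "r = (m mod (2 * int k * M), n mod (2 * int k * N))"
    show "\<exists>!s. s \<in> ?v ` ?P \<and> x - s \<in> ?L"
    proof (rule ex1I[of _ "?v r"])
      have "r \<in> ?P" using x k MN_pos by (simp add: r_def dvd_mod_iff)
      moreover have "x - ?v r \<in> ?L"
        unfolding x r_def fst_conv snd_conv L
        by (intro exI[of _ "m div (2 * int k * M)"] exI[of _ "n div (2 * int k * N)"]) simp
      ultimately show "?v r \<in> ?v ` ?P \<and> x - ?v r \<in> ?L" by (intro conjI imageI)
      fix s' assume "s' \<in> ?v ` ?P \<and> x - s' \<in> ?L"
      then obtain s where s: "s \<in> ?P" "s' = ?v s" "x - ?v s \<in> ?L" by (elim conjE imageE) simp
      obtain i j where "m = fst s + 2 * int k * M * i" "n = snd s + 2 * int k * N * j"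
        using s(3) unfolding x L by blast
      moreover have "fst s \<in> {0..<2 * int k * M}" "snd s \<in> {0..<2 * int k * N}" using s(1) by auto
      ultimately have "r = s" by (simp add: r_def prod_eq_iff)
      then show "s' = ?v r" using s(2) by simp
    qed
  qed
  also have "\<dots> = (\<Sum>p\<in>?P. F (?v p))"
    by (intro sum.reindex_cong[of ?v]) (auto simp: inj_on_def v_eq prod_eq_iff)
  also have "\<dots> = (\<Sum>p\<in>{0..<2 * int k * M} \<times> {0..<2 * int k * N}. f (fst p) (snd p))"
    unfolding F using zero by (intro sum.mono_neutral_left) auto
  finally show ?thesis by (simp add: S_lattice sum.cartesian_product case_prod_beta)
qed

end

theorem proposition6p1:
  fixes w :: "int ^ 6" and k :: nat
  assumes "\<forall>v. w $ v < 0"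
    and "negative_definite (linking_matrix w)"
    and "det (linking_matrix w) = 1"
    and "k > 0"
  shows
    "let S = S_block w;
         M = w $ 3 * w $ 4;
         N = w $ 5 * w $ 6;
         c = \<i> * zeta k (- (18 + (\<Sum>v\<in>UNIV. of_int (w $ v))
                               + (\<Sum>v\<in>{3,4,5,6}. 1 / of_int (w $ v))) / 4)
             / (4 * of_nat k * (zeta (2 * k) 1 - inverse (zeta (2 * k) 1))
                * of_real (sqrt (of_int (M * N))));
         U = {m :: int. \<not> int k dvd m}
     in
       tau k w = c *
         coset_sum U (range (\<lambda>x. 2 * int k * (w $ 3 * w $ 4) * x)) (\<lambda>m.
           coset_sum U (range (\<lambda>x. 2 * int k * (w $ 5 * w $ 6) * x)) (\<lambda>n.
             (let \<mu> = vector [of_int m, of_int n] :: real ^ 2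
              in zeta k (- (\<mu> \<bullet> (matrix_inv S *v \<mu>)) / 4))
             * A_coeff k (w $ 3) (w $ 4) m * A_coeff k (w $ 5) (w $ 6) n))
       \<and>
       tau k w = c *
         coset_sum {vector [of_int m, of_int n] :: real ^ 2 | m n. m \<in> U \<and> n \<in> U}
           {(2 * real k) *\<^sub>R (S *v x) | x. \<forall>i. x $ i \<in> \<int>}
           (\<lambda>\<mu>. zeta k (- (\<mu> \<bullet> (matrix_inv S *v \<mu>)) / 4)
                * G (w $ 3) (w $ 4) (zeta k (\<mu> $ 1 / (2 * of_int M)))
                * G (w $ 5) (w $ 6) (zeta k (\<mu> $ 2 / (2 * of_int N))))
       \<and>
       (\<forall>(p, q) \<in> {(w $ 3, w $ 4), (w $ 5, w $ 6)}. \<bar>p\<bar> > 1 \<and> \<bar>q\<bar> > 1 \<longrightarrow>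
          (\<forall>z. norm z < 1 \<longrightarrow>
             (\<lambda>n. - (of_int (chi p q (int (Suc n))) * z ^ Suc n)) sums G p q z))
       \<and>
       (\<forall>p q. p * q > 0 \<and> p \<noteq> q \<and> \<bar>p\<bar> > 1 \<and> \<bar>q\<bar> > 1 \<longrightarrow>
          (\<forall>z. norm z < 1 \<longrightarrow>
             (\<lambda>n. - (of_int (chi p q (int (Suc n))) * z ^ Suc n)) sums G p q z))"
proof -
  interpret H_graph w using assms by unfold_locales auto
  note k = \<open>k > 0\<close>
  let ?U = "{m :: int. \<not> int k dvd m}"
  let ?\<Sigma> = "\<Sum>x\<in>{0..<2 * int k * M}. \<Sum>y\<in>{0..<2 * int k * N}. summand k x y"
  have form: "zeta k (- (vector [of_int m, of_int n] \<bullet> (matrix_inv (S_block w) *v vector [of_int m,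
      of_int n])) / 4) = Q k m n"
    for m n by (simp only: quadratic_form Q_def minus_minus)
  have inner: "coset_sum ?U (range (\<lambda>x. 2 * int k * N * x)) (\<lambda>n. summand k m n) =
      (\<Sum>y\<in>{0..<2 * int k * N}. summand k m y)" for m
  proof (rule coset_sum_residues)
    show "summand k m (x + 2 * int k * N * y) = summand k m x" for x y
      using summand_periodic[OF k, of m 0 x y] by simp
  qed (use k MN_pos summand_eq_0 in simp_all)
  have "coset_sum ?U (range (\<lambda>x. 2 * int k * M * x))
      (\<lambda>m. coset_sum ?U (range (\<lambda>x. 2 * int k * N * x)) (\<lambda>n. summand k m n)) = ?\<Sigma>"
    unfolding inner
  proof (rule coset_sum_residues)
    show "(\<Sum>n\<in>{0..<2 * int k * N}. summand k (x + 2 * int k * M * y) n) = (\<Sum>n\<in>{0..<2 *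
        int k * N}. summand k x n)" for x y
      using summand_periodic[OF k, of x y _ 0] by simp
  qed (use k MN_pos summand_eq_0 in simp_all)
  then have first: "tau k w = prefactor k *
     coset_sum ?U (range (\<lambda>x. 2 * int k * (w $ 3 * w $ 4) * x)) (\<lambda>m.
           coset_sum ?U (range (\<lambda>x. 2 * int k * (w $ 5 * w $ 6) * x)) (\<lambda>n.
             (let \<mu> = vector [of_int m, of_int n] :: real ^ 2
              in zeta k (- (\<mu> \<bullet> (matrix_inv (S_block w) *v \<mu>)) / 4))
             * A_coeff k (w $ 3) (w $ 4) m * A_coeff k (w $ 5) (w $ 6) n))"
    unfolding Let_def form summand_def[symmetric] M_def[symmetric] N_def[symmetric] by (simp only:
        tau_reduced[OF k])
  have second: "tau k w = prefactor k *
         coset_sum {vector [of_int m, of_int n] :: real ^ 2 | m n. m \<in> ?U \<and> n \<in> ?U}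
           {(2 * real k) *\<^sub>R (S_block w *v x) | x. \<forall>i. x $ i \<in> \<int>}
           (\<lambda>\<mu>. zeta k (- (\<mu> \<bullet> (matrix_inv (S_block w) *v \<mu>)) / 4)
                * G (w $ 3) (w $ 4) (zeta k (\<mu> $ 1 / (2 * of_int (w $ 3 * w $ 4))))
                * G (w $ 5) (w $ 6) (zeta k (\<mu> $ 2 / (2 * of_int (w $ 5 * w $ 6)))))"
    unfolding tau_reduced[OF k] mem_Collect_eq
    by (subst coset_sum_pairs[OF k summand_periodic[OF k] summand_eq_0[OF k]])
      (simp_all only: form vector_2 G_zeta nonzero summand_def not_False_eq_True)
  have leaves: "p * q > 0 \<and> p \<noteq> q" if "(p, q) \<in> {(w $ 3, w $ 4), (w $ 5, w $ 6)}"
      "\<bar>p\<bar> > 1" for p q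
    using that coprime_leaves MN_pos by (auto simp: M_def N_def)
  have third: "\<forall>(p, q) \<in> {(w $ 3, w $ 4), (w $ 5, w $ 6)}. \<bar>p\<bar> > 1 \<and>
      \<bar>q\<bar> > 1 \<longrightarrow>
          (\<forall>z. norm z < 1 \<longrightarrow>
             (\<lambda>n. - (of_int (chi p q (int (Suc n))) * z ^ Suc n)) sums G p q z)"
    unfolding Ball_def split_paired_All prod.case
    by (intro allI impI, rule G_series) (use leaves in blast)+
  have fourth: "\<forall>p q. p * q > 0 \<and> p \<noteq> q \<and> \<bar>p\<bar> > 1 \<and> \<bar>q\<bar> >
      1 \<longrightarrow>
          (\<forall>z. norm z < 1 \<longrightarrow>
             (\<lambda>n. - (of_int (chi p q (int (Suc n))) * z ^ Suc n)) sums G p q z)"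
    by (intro allI impI, rule G_series) blast+
  show ?thesis
    using first second third fourth unfolding prefactor_def M_def N_def Let_def[of "S_block w"] Let_def by
        (intro conjI)
qed

end
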